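(* Let $A=\{\mathbf{a}_1,\ldots,\mathbf{a}_p\}$ and $B=\{\mathbf{b}_1,\ldots,\mathbf{b}_q\}$ be two finite subsets of $\mathbb{N}^2$ such that $k[A]$ and $k[B]$ are Cohen-Macaulay. Then $\langle A\rangle$ and $\langle B\rangle$ can be glued if and only if, possibly after interchanging the roles of $A$ and $B$, the set $B$ satisfies one of the following two conditions for some $\mathbf{b}\in\mathbb{N}^2$: (i) $q=1$ and $B=\{\mathbf{b}\}$; or (ii) $q\geq 2$ and there are $u_1,\ldots,u_q\in\mathbb{N}$ with $\mathbf{b}_j=u_j\mathbf{b}$ for all $j=1,\ldots,q$; and, for this $\mathbf{b}$, the system $A\cdot X=d\,\mathbf{b}$ has a solution $X\in\mathbb{N}^p$ for some integer $d\ge 1$. In this case, if $\langle C\rangle$ is a gluing of $\langle A\rangle$ and $\langle B\rangle$, then $k[C]$ is Cohen-Macaulay.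
   Context: Here $\mathbb{N}=\{0,1,2,\ldots\}$ and $k$ is an arbitrary field. All generators $\mathbf{a}_i,\mathbf{b}_j$ of semigroups are nonzero vectors. For $A=\{\mathbf{a}_1,\ldots,\mathbf{a}_p\}\subset\mathbb{N}^2$, $\langle A\rangle$ is the semigroup of all $\mathbb{N}$-linear combinations of elements of $A$, and $A$ also denotes the $2\times p$ integer matrix with columns $\mathbf{a}_1,\ldots,\mathbf{a}_p$. $I_A$ is the kernel of the $k$-algebra map $k[x_1,\ldots,x_p]\to k[t_1,t_2]$, $x_j\mapsto t^{\mathbf{a}_j}=t_1^{a_{1j}}t_2^{a_{2j}}$, and $k[A]\simeq k[x_1,\ldots,x_p]/I_A$ is the semigroup ring. Similarly for $B$, with variables $y_1,\ldots,y_q$, $I_B\subset k[y_1,\ldots,y_q]$ and $k[B]\simeq k[y_1,\ldots,y_q]/I_B$. For positive integers $k_1,k_2$ and $C=k_1A\cup k_2B$, let $I_C\subset R=k[x_1,\ldots,x_p,y_1,\ldots,y_q]$ be the kernel of the $k$-algebra map $R\to k[t_1,t_2]$, $x_i\mapsto t^{k_1\mathbf{a}_i}$, $y_j\mapsto t^{k_2\mathbf{b}_j}$, and $k[C]\simeq R/I_C$. One says that $\langle C\rangle$ is a gluing of $\langle A\rangle$ and $\langle B\rangle$ if $I_C=I_AR+I_BR+\langle\rho\rangle$ for some nonzero binomial $\rho=x_1^{\alpha_1}\cdots x_p^{\alpha_p}-y_1^{\beta_1}\cdots y_q^{\beta_q}$ with $\alpha\in\mathbb{N}^p$, $\beta\in\mathbb{N}^q$.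 The semigroups $\langle A\rangle$ and $\langle B\rangle$ can be glued if there exist positive integers $k_1,k_2$ such that, for $C=k_1A\cup k_2B$, $\langle C\rangle$ is a gluing of $\langle A\rangle$ and $\langle B\rangle$. *)

theory Defs
  imports
    "HOL-Analysis.Cartesian_Space"
    "HOL-Library.Poly_Mapping"
    "HOL-Library.Extended_Nat"
    "HOL-Algebra.Ring_Divisibility"
    "HOL-Algebra.Algebraic_Closure_Type"
begin

section \<open>Cohen-Macaulay rings\<close>

text \<open>
  A list \<open>[r\<^sub>1, \<dots>, r\<^sub>n]\<close> is a regular sequence if \<open>r\<^sub>i\<close> is a nonzerodivisor on
  \<open>R / (r\<^sub>1, \<dots>, r\<^sub>i\<^sub>-\<^sub>1)\<close> for all \<open>i\<close>, and \<open>(r\<^sub>1, \<dots>, r\<^sub>n)\<close> is a proper ideal.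
\<close>

definition regular_sequence :: "('a, 'm) ring_scheme \<Rightarrow> 'a list \<Rightarrow> bool" where
  "regular_sequence R rs \<longleftrightarrow>
     set rs \<subseteq> carrier R \<and>
     (\<forall>i < length rs. \<forall>x \<in> carrier R.
        (rs ! i) \<otimes>\<^bsub>R\<^esub> x \<in> genideal R (set (take i rs)) \<longrightarrow> x \<in> genideal R (set (take i rs))) \<and>
     genideal R (set rs) \<noteq> carrier R"

definition ideal_depth :: "('a, 'm) ring_scheme \<Rightarrow> 'a set \<Rightarrow> enat" where
  "ideal_depth R I = Sup {enat (length rs) | rs. regular_sequence R rs \<and> set rs \<subseteq> I}"

definition prime_height :: "('a, 'm) ring_scheme \<Rightarrow> 'a set \<Rightarrow> enat" where
  "prime_height R P =
     Sup {enat n | n. \<exists>Q. (\<forall>i \<le> n. primeideal (Q i) R) \<and> (\<forall>i < n. Q i \<subset> Q (Suc i)) \<and> Q n = P}"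

text \<open>
  The definition of Eisenbud, \<^emph>\<open>Commutative Algebra\<close>, Section 18.2: a Noetherian commutative ring
  is Cohen-Macaulay if depth and height (codimension) agree for every maximal ideal.
\<close>

definition cohen_macaulay :: "('a, 'm) ring_scheme \<Rightarrow> bool" where
  "cohen_macaulay R \<longleftrightarrow>
     cring R \<and> noetherian_ring R \<and>
     (\<forall>P. maximalideal P R \<longrightarrow> ideal_depth R P = prime_height R P)"

section \<open>Polynomial rings\<close>

text \<open>
  The polynomial ring over \<open>'k\<close> in variables indexed by the finite type \<open>'n\<close> is the monoid algebra
  of \<open>\<nat>\<^sup>n\<close>: finitely supported coefficient functions on exponent vectors, with convolution as
  multiplication.  In particular \<open>('k, 2) mpoly\<close> is \<open>k[t\<^sub>1, t\<^sub>2]\<close>, and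
  \<open>Poly_Mapping.single v 1\<close> is the monomial with exponent vector \<open>v\<close>.
\<close>

type_synonym ('k, 'n) mpoly = "(nat ^ 'n) \<Rightarrow>\<^sub>0 'k"

definition mvar :: "'n \<Rightarrow> ('k :: field, 'n :: finite) mpoly" where
  "mvar i = Poly_Mapping.single (axis i 1) 1"

definition mconst :: "'k :: field \<Rightarrow> ('k, 'n :: finite) mpoly" where
  "mconst c = Poly_Mapping.single 0 c"

text \<open>The \<open>k\<close>-algebra map of polynomial rings sending the \<open>i\<close>-th variable to \<open>g i\<close>.\<close>

definition mpoly_map ::
    "('n \<Rightarrow> ('k, 'm) mpoly) \<Rightarrow> ('k :: field, 'n :: finite) mpoly \<Rightarrow> ('k, 'm :: finite) mpoly" where
  "mpoly_map g f =
     (\<Sum>\<alpha> \<in> Poly_Mapping.keys f. mconst (Poly_Mapping.lookup f \<alpha>) * (\<Prod>i\<in>UNIV. g i ^ (\<alpha> $ i)))"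

section \<open>Affine semigroups, toric ideals and semigroup rings\<close>

text \<open>
  A family of \<open>p\<close> vectors in \<open>\<nat>\<^sup>2\<close> is given by the \<open>2 \<times> p\<close> matrix having them as columns; the
  number of columns is the cardinality of the index type.
\<close>

definition generated_semigroup :: "nat ^ 'p ^ 2 \<Rightarrow> (nat ^ 2) set" where
  "generated_semigroup A = range (\<lambda>x. A *v x)"

definition toric_ideal :: "nat ^ 'p ^ 2 \<Rightarrow> ('k :: field, 'p :: finite) mpoly set" where
  "toric_ideal A = {f. mpoly_map (\<lambda>j. Poly_Mapping.single (column j A) 1 :: ('k, 2) mpoly) f = 0}"

definition semigroup_ring :: "nat ^ 'p ^ 2 \<Rightarrow> ('k :: field, 2) mpoly ring" where
  "semigroup_ring A =
     ring_of_type_algebra \<lparr>carrier := {f. Poly_Mapping.keys f \<subseteq> generated_semigroup A}\<rparr>"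

section \<open>Gluing\<close>

text \<open>The matrix of the generators \<open>C = k\<^sub>1 A \<union> k\<^sub>2 B\<close>.\<close>

definition glue_matrix ::
    "nat \<Rightarrow> nat \<Rightarrow> nat ^ 'p ^ 2 \<Rightarrow> nat ^ 'q ^ 2 \<Rightarrow> nat ^ ('p + 'q) ^ 2" where
  "glue_matrix k1 k2 A B =
     (\<chi> r s. case s of Inl i \<Rightarrow> k1 * A $ r $ i | Inr j \<Rightarrow> k2 * B $ r $ j)"

text \<open>
  In \<open>R = k[x\<^sub>1, \<dots>, x\<^sub>p, y\<^sub>1, \<dots>, y\<^sub>q]\<close> the variables \<open>x\<^sub>i\<close> and \<open>y\<^sub>j\<close> are \<open>mvar (Inl i)\<close> and
  \<open>mvar (Inr j)\<close>.  Whether \<open>\<langle>C\<rangle>\<close> is a gluing refers to the ground field, which is passed as a type.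
\<close>

definition is_gluing ::
    "'k :: field itself \<Rightarrow> nat \<Rightarrow> nat \<Rightarrow> nat ^ 'p :: finite ^ 2 \<Rightarrow> nat ^ 'q :: finite ^ 2 \<Rightarrow> bool" where
  "is_gluing _ k1 k2 A B \<longleftrightarrow>
     (let R = (ring_of_type_algebra :: ('k, 'p + 'q) mpoly ring) in
      \<exists>(\<alpha> :: nat ^ 'p) (\<beta> :: nat ^ 'q) \<rho>.
        \<rho> = (\<Prod>i\<in>UNIV. mvar (Inl i) ^ (\<alpha> $ i)) - (\<Prod>j\<in>UNIV. mvar (Inr j) ^ (\<beta> $ j)) \<and>
        \<rho> \<noteq> 0 \<and>
        toric_ideal (glue_matrix k1 k2 A B) =
          set_add R
            (set_add R
               (genideal R (mpoly_map (\<lambda>i. mvar (Inl i)) ` toric_ideal A))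
               (genideal R (mpoly_map (\<lambda>j. mvar (Inr j)) ` toric_ideal B)))
            (genideal R {\<rho>}))"

definition can_be_glued ::
    "'k :: field itself \<Rightarrow> nat ^ 'p :: finite ^ 2 \<Rightarrow> nat ^ 'q :: finite ^ 2 \<Rightarrow> bool" where
  "can_be_glued K A B \<longleftrightarrow> (\<exists>k1 > 0. \<exists>k2 > 0. is_gluing K k1 k2 A B)"

definition gluing_condition :: "nat ^ 'p ^ 2 \<Rightarrow> nat ^ 'q ^ 2 \<Rightarrow> bool" where
  "gluing_condition A B \<longleftrightarrow>
     (\<exists>b :: nat ^ 2.
        (CARD('q) = 1 \<and> columns B = {b} \<or>
         CARD('q) \<ge> 2 \<and> (\<exists>u :: 'q \<Rightarrow> nat. \<forall>j. column j B = u j *s b)) \<and>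
        (\<exists>d x. d \<ge> 1 \<and> A *v x = d *s b))"

section \<open>Basic consequences of the definitions\<close>

lemma semigroup_ring_simps:
  "carrier (semigroup_ring A :: ('k::field,2) mpoly ring) = {f. Poly_Mapping.keys f \<subseteq> generated_semigroup A}"
  "monoid.mult (semigroup_ring A :: ('k,2) mpoly ring) = (*)"
  "ring.add (semigroup_ring A :: ('k,2) mpoly ring) = (+)"
  "monoid.one (semigroup_ring A :: ('k,2) mpoly ring) = 1"
  "ring.zero (semigroup_ring A :: ('k,2) mpoly ring) = 0"
  by (auto simp: semigroup_ring_def ring_of_type_algebra_def)

lemma cring_semigroup_ring: "cring (semigroup_ring A :: ('k::field,2) mpoly ring)"
proof -
  have cl: "0 \<in> generated_semigroup A" 
    unfolding generated_semigroup_def by (metis matrix_vector_mult_0_right rangeI)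
  have cl2: "x + y \<in> generated_semigroup A" if "x \<in> generated_semigroup A" "y \<in> generated_semigroup A" for x y
    using that unfolding generated_semigroup_def by (auto simp flip: matrix_vector_right_distrib)
  show ?thesis
  proof (rule cringI)
    show "abelian_group (semigroup_ring A :: ('k,2) mpoly ring)"
    proof (rule abelian_groupI, unfold semigroup_ring_simps, goal_cases)
      case (1 x y) then show ?case using Poly_Mapping.keys_add[of x y] by auto
    next case (6 x)
      then have "-x \<in> {f. Poly_Mapping.keys f \<subseteq> generated_semigroup A}" by (auto simp: in_keys_iff)
      then show ?case by (metis add.left_inverse)
    qed (auto simp: algebra_simps)
    show "comm_monoid (semigroup_ring A :: ('k,2) mpoly ring)"
    proof (rule comm_monoidI, unfold semigroup_ring_simps, goal_cases)
      case (1 x y) then show ?case using keys_mult[of x y] cl2 by fastforce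
    next case 2 show ?case using cl by simp
    qed (auto simp: algebra_simps)
  qed (auto simp: semigroup_ring_simps algebra_simps)
qed

lemma column_glue:
  "column (Inl i) (glue_matrix k1 k2 A B) = k1 *s column i A"
  "column (Inr j) (glue_matrix k1 k2 A B) = k2 *s column j B"
  by (simp_all add: glue_matrix_def column_def vec_eq_iff)

lemma monom_pow: "(Poly_Mapping.single (v::nat^2) (1::'k::field)) ^ n = Poly_Mapping.single (n *s v) 1"
  by (induction n) (auto simp: mult_single vec_eq_iff algebra_simps intro!: arg_cong2[where f=Poly_Mapping.single])

lemma monom_prod: "(\<Prod>i\<in>S. Poly_Mapping.single (g i) (1::'k::field)) = Poly_Mapping.single (\<Sum>i\<in>S. g i) 1"
  by (induction S rule: infinite_finite_induct) (auto simp: mult_single)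

lemma toric_map_monomial:
  "mpoly_map (\<lambda>j. Poly_Mapping.single (column j A) 1 :: ('k::field, 2) mpoly) (Poly_Mapping.single \<alpha> 1)
     = Poly_Mapping.single (A *v \<alpha>) 1"
proof -
  have "(\<Sum>i\<in>UNIV. (\<alpha> $ i) *s column i A) = A *v \<alpha>"
    by (simp add: vec_eq_iff matrix_vector_mult_def column_def mult.commute)
  then show ?thesis by (simp add: mpoly_map_def mconst_def monom_pow monom_prod)
qed

end

theory Submission
  imports Defs
begin

text \<open>
  The ideal equation defining a gluing says that each coincidence
  \<open>k\<^sub>1 a + k\<^sub>2 b = k\<^sub>1 a' + k\<^sub>2 b'\<close> with \<open>a, a' \<in> \<langle>A\<rangle>\<close> and \<open>b, b' \<in> \<langle>B\<rangle>\<close> makes \<open>a - a'\<close> an integral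
  multiple of \<open>A \<alpha>\<close>: the groups generated by \<open>k\<^sub>1 A\<close> and \<open>k\<^sub>2 B\<close> meet in the multiples of one vector.
  Two planar groups of rank two meet in rank two, so one of \<open>A\<close> and \<open>B\<close> lies on a line.  Conversely,
  for \<open>b\<^sub>j = u\<^sub>j b\<close> and \<open>A x = d b\<close>, a gluing is obtained from \<open>k\<^sub>2 = d\<close> and a suitable
  \<open>k\<^sub>1 \<in> \<langle>u\<^sub>1, \<dots>, u\<^sub>q\<rangle>\<close>.

  If \<open>B\<close> lies on a line, then the Apery set of \<open>\<langle>B\<rangle>\<close> with respect to \<open>B \<beta>\<close> is finite, and
  \<open>k[C]\<close> is a free module over \<open>k[k\<^sub>1 A] \<simeq> k[A]\<close> with the corresponding monomials as a basis.  A
  finite free extension of a Cohen-Macaulay ring is Cohen-Macaulay: regular sequences extend along it,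
  chains of primes contract to strict chains, maximal ideals contract to maximal ideals, and in a
  Noetherian ring the depth of a prime never exceeds its height.
\<close>

subsection \<open>Depth and height\<close>

text \<open>The ideal equation becomes a statement about degrees that mentions no field. One way, a
  monomial is sent to its degree in \<open>C\<close> paired with the class of its
  \<open>A\<close>-part modulo multiples of \<open>A \<alpha>\<close>; the linear extension of this
  map vanishes on all generators of the right-hand side, hence on I_C. For the way back, the kernel
  of a monomial map is spanned by binomials, so only single coincidences have to be rewritten.

  Let \<open>g\<close> be the greatest common divisor of the \<open>u_j\<close>. The choice is
  \<open>k1 = g m\<close> with \<open>m\<close> prime to \<open>d b_r\<close>, where
  \<open>b_r > 0\<close>: after cancelling \<open>g\<close>, a coincidence reads
  \<open>m (a - a') = d (t' - t) b\<close>, and coprimality forces \<open>m\<close> to divide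
  \<open>t' - t\<close>, so that \<open>a - a'\<close> is a multiple of \<open>d b = A x\<close>.

  The Cohen-Macaulay property is a condition at every maximal ideal, graded or not, and depth is
  measured by regular sequences in the ring itself. Hence a maximal ideal \<open>P\<close> of
  \<open>k[C]\<close> is compared directly with its contraction \<open>p\<close>: height of
  \<open>P\<close> \<le> height of \<open>p\<close> = depth of \<open>p\<close> \<le> depth of
  \<open>P\<close> \<le> height of \<open>P\<close>.\<close>

lemma (in noetherian_ring) ideal_family_has_maximal:
  assumes "F \<noteq> {}" "\<And>I. I \<in> F \<Longrightarrow> ideal I R"
  shows "\<exists>M\<in>F. \<forall>I\<in>F. M \<subseteq> I \<longrightarrow> I = M"
proof -
  have "\<exists>M\<in>F. \<forall>I\<in>F. M \<subseteq> I \<longrightarrow> I = M" if "\<And>C. C \<noteq> {} \<Longrightarrow> subset.chain F C \<Longrightarrow> \<Union>C \<in> F"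
    using assms(1) that by (rule subset_Zorn_nonempty)
  moreover have "\<Union>C \<in> F" if C: "C \<noteq> {}" "subset.chain F C" for C
  proof -
    have "subset.chain {I. ideal I R} C"
      using C(2) assms(2) by (auto simp: pred_on.chain_def)
    then show ?thesis
      using ideal_chain_is_trivial[OF C(1)] C(2) by (auto simp: pred_on.chain_def)
  qed
  ultimately show ?thesis by blast
qed

lemma (in cring) cring_idealI:
  assumes "I \<subseteq> carrier R" "\<zero> \<in> I" "\<And>x y. x \<in> I \<Longrightarrow> y \<in> I \<Longrightarrow> x \<oplus> y \<in> I"
    and mult: "\<And>r x. r \<in> carrier R \<Longrightarrow> x \<in> I \<Longrightarrow> r \<otimes> x \<in> I"
  shows "ideal I R"
proof (rule idealI)
  have "\<ominus> x \<in> I" if "x \<in> I" for x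
  proof -
    have "x \<in> carrier R" using that assms(1) by blast
    then have "(\<ominus> \<one>) \<otimes> x = \<ominus> x" by (simp add: l_minus)
    then show ?thesis using mult[OF _ that, of "\<ominus> \<one>"] by simp
  qed
  then show "subgroup I (add_monoid R)"
    using assms by (intro subgroup.intro) (auto simp: a_inv_def)
  show "r \<otimes> x \<in> I" if "x \<in> I" "r \<in> carrier R" for x r using mult that by blast
  show "x \<otimes> r \<in> I" if "x \<in> I" "r \<in> carrier R" for x r
    using mult[OF that(2,1)] that assms(1) by (simp add: m_comm subset_iff)
qed (rule ring_axioms)

text \<open>An ideal maximal among those that contain \<open>I\<close> and miss \<open>T\<close> is
  prime: if \<open>a\<close> and \<open>b\<close> lie outside it, adjoining either one produces an
  element of \<open>T\<close>, and the product of these two elements stays in \<open>T\<close> but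
  would fall into the ideal if \<open>a \<otimes> b\<close> did.\<close>

lemma (in cring) prime_ideal_avoiding:
  assumes noeth: "noetherian_ring R"
    and I: "ideal I R"
    and T: "T \<subseteq> carrier R" "\<one> \<in> T" "\<And>x y. x \<in> T \<Longrightarrow> y \<in> T \<Longrightarrow> x \<otimes> y \<in> T"
    and disj: "I \<inter> T = {}"
  obtains Q where "primeideal Q R" "I \<subseteq> Q" "Q \<inter> T = {}"
proof -
  define F where "F = {J. ideal J R \<and> I \<subseteq> J \<and> J \<inter> T = {}}"
  have "F \<noteq> {}" "\<And>J. J \<in> F \<Longrightarrow> ideal J R"
    using I disj by (auto simp: F_def)
  then obtain Q where Q: "Q \<in> F" and max: "\<And>J. J \<in> F \<Longrightarrow> Q \<subseteq> J \<Longrightarrow> J = Q"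
    using noetherian_ring.ideal_family_has_maximal[OF noeth] by meson
  have idQ: "ideal Q R" and IQ: "I \<subseteq> Q" and QT: "Q \<inter> T = {}" using Q by (auto simp: F_def)
  interpret Q: ideal Q R by fact
  have meets: "\<exists>q\<in>Q. \<exists>x\<in>carrier R. q \<oplus> x \<otimes> a \<in> T" if a: "a \<in> carrier R" "a \<notin> Q" for a
  proof -
    define K where "K = set_add R Q (PIdl a)"
    have id: "ideal K R"
      unfolding K_def using add_ideals[OF idQ cgenideal_ideal[OF a(1)]] .
    have "q \<in> K" if "q \<in> Q" for q
    proof -
      have "q = q \<oplus> \<zero>" "\<zero> \<in> PIdl a"
        using that Q.Icarr a cgenideal_ideal[OF a(1)]
        by (auto intro: additive_subgroup.zero_closed ideal.axioms)
      then show ?thesis using that unfolding K_def set_add_def' by blast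
    qed
    moreover have "a \<in> K"
    proof -
      have "a = \<zero> \<oplus> a" using a by simp
      then show ?thesis unfolding K_def set_add_def' using cgenideal_self[OF a(1)] Q.zero_closed by blast
    qed
    ultimately have "K \<notin> F" using max[of K] a(2) by blast
    moreover have "I \<subseteq> K" using IQ \<open>\<And>q. q \<in> Q \<Longrightarrow> q \<in> K\<close> by blast
    ultimately obtain t where "t \<in> K" "t \<in> T" using id by (auto simp: F_def)
    then show ?thesis unfolding K_def set_add_def' cgenideal_def by blast
  qed
  have "primeideal Q R"
  proof (rule primeidealI[OF idQ is_cring])
    show "carrier R \<noteq> Q" using T QT by auto
    fix a b assume ab: "a \<in> carrier R" "b \<in> carrier R" "a \<otimes> b \<in> Q"
    show "a \<in> Q \<or> b \<in> Q"
    proof (rule ccontr)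
      assume n: "\<not> (a \<in> Q \<or> b \<in> Q)"
      obtain q x where qx: "q \<in> Q" "x \<in> carrier R" "q \<oplus> x \<otimes> a \<in> T" using meets ab n by blast
      obtain r y where ry: "r \<in> Q" "y \<in> carrier R" "r \<oplus> y \<otimes> b \<in> T" using meets ab n by blast
      have qr: "q \<in> carrier R" "r \<in> carrier R" using qx ry Q.Icarr by auto
      have "(q \<oplus> x \<otimes> a) \<otimes> (r \<oplus> y \<otimes> b) = q \<otimes> (r \<oplus> y \<otimes> b) \<oplus> ((x \<otimes> a) \<otimes> r \<oplus> (x \<otimes> y) \<otimes> (a \<otimes> b))"
        using ab qx(2) ry(2) qr by algebra
      also have "\<dots> \<in> Q"
        using ab qx ry qr
        by (intro Q.a_closed Q.I_r_closed[of q] Q.I_l_closed[of r] Q.I_l_closed[of "a \<otimes> b"]) auto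
      finally show False using T(3)[OF qx(3) ry(3)] QT by blast
    qed
  qed
  then show ?thesis using that IQ QT by blast
qed

text \<open>
  A prime \<open>P\<close> containing a regular sequence ending in \<open>r\<close> strictly contains a prime over the
  remaining elements: regularity of \<open>r\<close> makes the set of all \<open>s r\<^sup>k\<close> with \<open>s \<notin> P\<close> disjoint from
  the ideal that they generate.
\<close>

lemma (in cring) prime_chain_of_regular_sequence:
  assumes "noetherian_ring R"
  shows "primeideal P R \<Longrightarrow> set rs \<subseteq> P \<Longrightarrow>
    (\<And>i x. i < length rs \<Longrightarrow> x \<in> carrier R \<Longrightarrow> rs ! i \<otimes> x \<in> Idl (set (take i rs)) \<Longrightarrow> x \<in> Idl (set (take i rs)))
    \<Longrightarrow> \<exists>Q. (\<forall>i \<le> length rs. primeideal (Q i) R) \<and> (\<forall>i < length rs. Q i \<subset> Q (Suc i)) \<and> Q (length rs) = P"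
proof (induction rs arbitrary: P rule: rev_induct)
  case Nil
  then show ?case by (intro exI[of _ "\<lambda>_. P"]) auto
next
  case (snoc r rs)
  interpret P: primeideal P R by fact
  have rs: "set rs \<subseteq> P" "r \<in> P" "r \<in> carrier R" using snoc.prems(2) P.Icarr by auto
  have rsc: "set rs \<subseteq> carrier R" using rs P.Icarr by auto
  define I where "I = Idl (set rs)"
  have idI: "ideal I R" using rsc by (simp add: I_def genideal_ideal)
  have IP: "I \<subseteq> P" unfolding I_def using genideal_minimal[OF P.ideal_axioms] rs by blast
  have reg: "x \<in> I" if "x \<in> carrier R" "r \<otimes> x \<in> I" for x
    using snoc.prems(3)[of "length rs" x] that by (simp add: I_def)
  define T where "T = {s \<otimes> r [^] k | s (k::nat). s \<in> carrier R - P}"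
  have "s \<in> I" if "s \<in> carrier R" "s \<otimes> r [^] (k::nat) \<in> I" for s k
    using that
  proof (induction k)
    case (Suc k)
    have "s \<otimes> r [^] Suc k = r \<otimes> (s \<otimes> r [^] k)"
      using Suc.prems rs by (simp add: m_lcomm m_comm)
    then show ?case using reg[of "s \<otimes> r [^] k"] Suc rs by simp
  qed simp
  then have disj: "I \<inter> T = {}" using IP by (auto simp: T_def)
  have oneP: "\<one> \<notin> P" using P.one_imp_carrier P.I_notcarr by blast
  have T: "T \<subseteq> carrier R" "\<one> \<in> T" "r \<in> T"
  proof -
    show "T \<subseteq> carrier R" using rs by (auto simp: T_def)
    have "\<one> = \<one> \<otimes> r [^] (0::nat)" by simp
    then show "\<one> \<in> T" unfolding T_def using oneP by blast
    have "r = \<one> \<otimes> r [^] (1::nat)" using rs by simp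
    then show "r \<in> T" unfolding T_def using oneP by blast
  qed
  have Tm: "x \<otimes> y \<in> T" if xy: "x \<in> T" "y \<in> T" for x y
  proof -
    obtain s k t l where st: "x = s \<otimes> r [^] (k::nat)" "s \<in> carrier R - P" "y = t \<otimes> r [^] (l::nat)" "t \<in> carrier R - P"
      using xy unfolding T_def by blast
    have "x \<otimes> y = (s \<otimes> t) \<otimes> (r [^] k \<otimes> r [^] l)" using st rs by (simp add: m_ac)
    then have "x \<otimes> y = (s \<otimes> t) \<otimes> r [^] (k + l)" using rs by (simp add: nat_pow_mult)
    moreover have "s \<otimes> t \<in> carrier R - P" using st P.I_prime by auto
    ultimately show ?thesis unfolding T_def by blast
  qed
  obtain Q where Q: "primeideal Q R" "I \<subseteq> Q" "Q \<inter> T = {}"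
    using prime_ideal_avoiding[OF assms idI T(1,2) Tm disj] by blast
  \<comment> \<open>\<open>T\<close> contains the complement of \<open>P\<close> (exponent 0), so
    \<open>Q \<subseteq> P\<close>; it also contains \<open>r\<close>, which lies in
    \<open>P\<close>, so the inclusion is strict.\<close>
  have QP: "Q \<subset> P"
  proof
    show "Q \<subseteq> P"
    proof
      fix x assume x: "x \<in> Q"
      then have xc: "x \<in> carrier R" using Q(1) by (meson ideal.Icarr primeideal.axioms(1))
      show "x \<in> P"
      proof (rule ccontr)
        assume "x \<notin> P"
        then have "x \<otimes> r [^] (0::nat) \<in> T" unfolding T_def using xc by blast
        then show False using x xc Q by auto
      qed
    qed
    show "Q \<noteq> P" using rs T Q by blast
  qed
  have "set rs \<subseteq> Q" using Q(2) genideal_self[OF rsc] by (auto simp: I_def)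
  moreover have "x \<in> Idl (set (take i rs))"
    if "i < length rs" "x \<in> carrier R" "rs ! i \<otimes> x \<in> Idl (set (take i rs))" for i x
    using snoc.prems(3)[of i x] that by (simp add: nth_append)
  ultimately obtain Q' where Q': "\<forall>i \<le> length rs. primeideal (Q' i) R"
    "\<forall>i < length rs. Q' i \<subset> Q' (Suc i)" "Q' (length rs) = Q"
    using snoc.IH[OF Q(1)] by blast
  define Q'' where "Q'' = (\<lambda>i. if i \<le> length rs then Q' i else P)"
  have "\<forall>i \<le> length (rs @ [r]). primeideal (Q'' i) R"
    using Q'(1) P.primeideal_axioms by (auto simp: Q''_def)
  moreover have "\<forall>i < length (rs @ [r]). Q'' i \<subset> Q'' (Suc i)"
    using Q'(2,3) QP by (auto simp: Q''_def less_Suc_eq)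
  moreover have "Q'' (length (rs @ [r])) = P" by (simp add: Q''_def)
  ultimately show ?case by blast
qed

lemma (in cring) ideal_depth_le_prime_height:
  assumes "noetherian_ring R" "primeideal P R"
  shows "ideal_depth R P \<le> prime_height R P"
  unfolding ideal_depth_def
proof (rule Sup_least, clarsimp)
  fix rs assume rs: "regular_sequence R rs" "set rs \<subseteq> P"
  obtain Q where Q: "\<forall>i \<le> length rs. primeideal (Q i) R" "\<forall>i < length rs. Q i \<subset> Q (Suc i)" "Q (length rs) = P"
    using prime_chain_of_regular_sequence[OF assms rs(2)] rs(1) unfolding regular_sequence_def by blast
  show "enat (length rs) \<le> prime_height R P"
    unfolding prime_height_def using Q by (intro Sup_upper) blast
qed

subsection \<open>Finite ring extensions\<close>

context ring_hom_cring
begin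

section \<open>Noetherian modules over the base ring\<close>

definition submod :: "'c set \<Rightarrow> bool" where
  "submod N \<longleftrightarrow> N \<subseteq> carrier S \<and> \<zero>\<^bsub>S\<^esub> \<in> N \<and> (\<forall>x\<in>N. \<forall>y\<in>N. x \<oplus>\<^bsub>S\<^esub> y \<in> N) \<and>
     (\<forall>r\<in>carrier R. \<forall>x\<in>N. h r \<otimes>\<^bsub>S\<^esub> x \<in> N)"

text \<open>The maximal condition is stated for arbitrary families, since the step that adjoins a
  generator selects a maximal member twice, the second time within a subfamily cut out by the first
  choice.\<close>

definition noetherian_submod :: "'c set \<Rightarrow> bool" where
  "noetherian_submod N \<longleftrightarrow> submod N \<and>
     (\<forall>F. F \<noteq> {} \<and> (\<forall>M\<in>F. submod M \<and> M \<subseteq> N) \<longrightarrow> (\<exists>M\<in>F. \<forall>L\<in>F. M \<subseteq> L \<longrightarrow> L = M))"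

lemma noetherian_submodD:
  assumes "noetherian_submod N" "F \<noteq> {}" "\<And>M. M \<in> F \<Longrightarrow> submod M" "\<And>M. M \<in> F \<Longrightarrow> M \<subseteq> N"
  shows "\<exists>M\<in>F. \<forall>L\<in>F. M \<subseteq> L \<longrightarrow> L = M"
  using assms unfolding noetherian_submod_def by (elim conjE) (drule spec, erule mp, blast)

lemma submodI:
  assumes "N \<subseteq> carrier S" "\<zero>\<^bsub>S\<^esub> \<in> N" "\<And>x y. x \<in> N \<Longrightarrow> y \<in> N \<Longrightarrow> x \<oplus>\<^bsub>S\<^esub> y \<in> N"
    "\<And>r x. r \<in> carrier R \<Longrightarrow> x \<in> N \<Longrightarrow> h r \<otimes>\<^bsub>S\<^esub> x \<in> N"
  shows "submod N"
  using assms by (auto simp: submod_def)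

lemma submodD:
  assumes "submod N"
  shows "N \<subseteq> carrier S" "\<zero>\<^bsub>S\<^esub> \<in> N" "\<And>x y. x \<in> N \<Longrightarrow> y \<in> N \<Longrightarrow> x \<oplus>\<^bsub>S\<^esub> y \<in> N"
    "\<And>r x. r \<in> carrier R \<Longrightarrow> x \<in> N \<Longrightarrow> h r \<otimes>\<^bsub>S\<^esub> x \<in> N"
  using assms by (auto simp: submod_def)

lemma submod_uminus:
  assumes "submod N" "x \<in> N"
  shows "\<ominus>\<^bsub>S\<^esub> x \<in> N"
proof -
  have "x \<in> carrier S" using assms submodD(1) by blast
  then have "h (\<ominus> \<one>) \<otimes>\<^bsub>S\<^esub> x = \<ominus>\<^bsub>S\<^esub> x" by (simp add: S.l_minus)
  then show ?thesis using submodD(4)[OF assms(1) _ assms(2), of "\<ominus> \<one>"] by simp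
qed

lemma ideal_submod:
  assumes "ideal I S"
  shows "submod I"
proof -
  interpret I: ideal I S by fact
  show ?thesis using I.Icarr by (intro submodI) (auto intro: I.I_l_closed)
qed

definition adjoin :: "'c \<Rightarrow> 'c set \<Rightarrow> 'c set" where
  "adjoin s N = {h a \<otimes>\<^bsub>S\<^esub> s \<oplus>\<^bsub>S\<^esub> x | a x. a \<in> carrier R \<and> x \<in> N}"

lemma submod_adjoin:
  assumes N: "submod N" and s: "s \<in> carrier S"
  shows "submod (adjoin s N)"
proof (rule submodI)
  note Nc = subsetD[OF submodD(1)[OF N]]
  show "adjoin s N \<subseteq> carrier S" using s Nc by (auto simp: adjoin_def)
  have "\<zero>\<^bsub>S\<^esub> = h \<zero> \<otimes>\<^bsub>S\<^esub> s \<oplus>\<^bsub>S\<^esub> \<zero>\<^bsub>S\<^esub>" using s by simp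
  then show "\<zero>\<^bsub>S\<^esub> \<in> adjoin s N" unfolding adjoin_def using submodD(2)[OF N] by blast
next
  note Nc = subsetD[OF submodD(1)[OF N]]
  fix x y assume "x \<in> adjoin s N" "y \<in> adjoin s N"
  then obtain a u b v where *: "x = h a \<otimes>\<^bsub>S\<^esub> s \<oplus>\<^bsub>S\<^esub> u" "y = h b \<otimes>\<^bsub>S\<^esub> s \<oplus>\<^bsub>S\<^esub> v"
    "a \<in> carrier R" "b \<in> carrier R" "u \<in> N" "v \<in> N" unfolding adjoin_def by blast
  have "x \<oplus>\<^bsub>S\<^esub> y = h (a \<oplus> b) \<otimes>\<^bsub>S\<^esub> s \<oplus>\<^bsub>S\<^esub> (u \<oplus>\<^bsub>S\<^esub> v)"
    using * s Nc by (simp add: S.l_distr S.a_ac)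
  then show "x \<oplus>\<^bsub>S\<^esub> y \<in> adjoin s N"
    unfolding adjoin_def using * submodD(3)[OF N] R.a_closed by blast
next
  note Nc = subsetD[OF submodD(1)[OF N]]
  fix r x assume r: "r \<in> carrier R" and "x \<in> adjoin s N"
  then obtain a u where *: "x = h a \<otimes>\<^bsub>S\<^esub> s \<oplus>\<^bsub>S\<^esub> u" "a \<in> carrier R" "u \<in> N" unfolding adjoin_def by blast
  have "h r \<otimes>\<^bsub>S\<^esub> x = h (r \<otimes> a) \<otimes>\<^bsub>S\<^esub> s \<oplus>\<^bsub>S\<^esub> h r \<otimes>\<^bsub>S\<^esub> u"
    using * r s Nc by (simp add: S.r_distr S.m_assoc)
  then show "h r \<otimes>\<^bsub>S\<^esub> x \<in> adjoin s N"
    unfolding adjoin_def using * r submodD(4)[OF N] R.m_closed by blast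
qed

text \<open>For submodules \<open>M \<subseteq> L\<close> of \<open>R s + N\<close>, the equalities
  \<open>lead M = lead L\<close> of coefficient ideals and
  \<open>M \<inter> N = L \<inter> N\<close> already give \<open>M = L\<close>. Hence it suffices to
  maximise the coefficient ideal first and the intersection with \<open>N\<close>
  afterwards.\<close>

lemma noetherian_submod_adjoin:
  assumes R: "noetherian_ring R" and N: "noetherian_submod N" and s: "s \<in> carrier S"
  shows "noetherian_submod (adjoin s N)"
proof -
  have sN: "submod N" using N by (simp add: noetherian_submod_def)
  note Nc = subsetD[OF submodD(1)[OF sN]]
  define lead where "lead M = {a \<in> carrier R. \<exists>x\<in>N. h a \<otimes>\<^bsub>S\<^esub> s \<oplus>\<^bsub>S\<^esub> x \<in> M}" for M
  have leadI: "a \<in> lead M" if "h a \<otimes>\<^bsub>S\<^esub> s \<oplus>\<^bsub>S\<^esub> x \<in> M" "a \<in> carrier R" "x \<in> N" for a x M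
    using that unfolding lead_def by blast
  have lead: "ideal (lead M) R" if M: "submod M" for M
  proof (rule R.cring_idealI)
    show "a \<oplus> b \<in> lead M" if ab: "a \<in> lead M" "b \<in> lead M" for a b
    proof -
      obtain x y where *: "a \<in> carrier R" "b \<in> carrier R" "x \<in> N" "y \<in> N"
        "h a \<otimes>\<^bsub>S\<^esub> s \<oplus>\<^bsub>S\<^esub> x \<in> M" "h b \<otimes>\<^bsub>S\<^esub> s \<oplus>\<^bsub>S\<^esub> y \<in> M"
        using ab unfolding lead_def by blast
      have "h (a \<oplus> b) \<otimes>\<^bsub>S\<^esub> s \<oplus>\<^bsub>S\<^esub> (x \<oplus>\<^bsub>S\<^esub> y) = (h a \<otimes>\<^bsub>S\<^esub> s \<oplus>\<^bsub>S\<^esub> x) \<oplus>\<^bsub>S\<^esub> (h b \<otimes>\<^bsub>S\<^esub> s \<oplus>\<^bsub>S\<^esub> y)"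
        using * s Nc by (simp add: S.l_distr S.a_ac)
      also have "\<dots> \<in> M" by (rule submodD(3)[OF M *(5,6)])
      finally show ?thesis by (rule leadI) (use * submodD(3)[OF sN *(3,4)] in auto)
    qed
    show "r \<otimes> a \<in> lead M" if ra: "r \<in> carrier R" "a \<in> lead M" for r a
    proof -
      obtain x where *: "a \<in> carrier R" "x \<in> N" "h a \<otimes>\<^bsub>S\<^esub> s \<oplus>\<^bsub>S\<^esub> x \<in> M"
        using ra unfolding lead_def by blast
      have "h (r \<otimes> a) \<otimes>\<^bsub>S\<^esub> s \<oplus>\<^bsub>S\<^esub> h r \<otimes>\<^bsub>S\<^esub> x = h r \<otimes>\<^bsub>S\<^esub> (h a \<otimes>\<^bsub>S\<^esub> s \<oplus>\<^bsub>S\<^esub> x)"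
        using * ra s Nc by (simp add: S.r_distr S.m_assoc)
      also have "\<dots> \<in> M" by (rule submodD(4)[OF M ra(1) *(3)])
      finally show ?thesis by (rule leadI) (use * ra submodD(4)[OF sN ra(1) *(2)] in auto)
    qed
    have "h \<zero> \<otimes>\<^bsub>S\<^esub> s \<oplus>\<^bsub>S\<^esub> \<zero>\<^bsub>S\<^esub> \<in> M" using s submodD(2)[OF M] by simp
    then show "\<zero> \<in> lead M" by (rule leadI) (use submodD(2)[OF sN] in auto)
    show "lead M \<subseteq> carrier R" by (auto simp: lead_def)
  qed
  show ?thesis
    unfolding noetherian_submod_def
  proof (intro conjI allI impI submod_adjoin[OF sN s])
    fix F assume F: "F \<noteq> {} \<and> (\<forall>M\<in>F. submod M \<and> M \<subseteq> adjoin s N)"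
    have "\<exists>I\<in>lead ` F. \<forall>L\<in>lead ` F. I \<subseteq> L \<longrightarrow> L = I"
      using F lead by (intro noetherian_ring.ideal_family_has_maximal[OF R]) auto
    then obtain M0 where M0: "M0 \<in> F" "\<And>M. M \<in> F \<Longrightarrow> lead M0 \<subseteq> lead M \<Longrightarrow> lead M = lead M0"
      by auto
    define G where "G = {M \<in> F. lead M = lead M0}"
    have "submod (M \<inter> N)" if "M \<in> G" for M
      using that F sN by (auto simp: G_def submod_def)
    moreover have "G \<noteq> {}" using M0(1) by (auto simp: G_def)
    ultimately have "\<exists>I\<in>(\<lambda>M. M \<inter> N) ` G. \<forall>L\<in>(\<lambda>M. M \<inter> N) ` G. I \<subseteq> L \<longrightarrow> L = I"
      by (intro noetherian_submodD[OF N]) auto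
    then obtain M where M: "M \<in> G" "\<And>L. L \<in> G \<Longrightarrow> M \<inter> N \<subseteq> L \<inter> N \<Longrightarrow> L \<inter> N = M \<inter> N" by auto
    show "\<exists>M\<in>F. \<forall>L\<in>F. M \<subseteq> L \<longrightarrow> L = M"
    proof (intro bexI ballI impI)
      show "M \<in> F" using M by (simp add: G_def)
      fix L assume L: "L \<in> F" "M \<subseteq> L"
      have sL: "submod L" and sM: "submod M" using F L M by (auto simp: G_def)
      have "lead M \<subseteq> lead L" using L(2) unfolding lead_def by blast
      then have leadL: "lead L = lead M0" using M0(2)[OF L(1)] M(1) by (simp add: G_def)
      then have "L \<in> G" using L by (simp add: G_def)
      then have LN: "L \<inter> N = M \<inter> N" using M(2)[of L] L(2) by blast
      have "x \<in> M" if x: "x \<in> L" for x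
      proof -
        obtain a u where au: "x = h a \<otimes>\<^bsub>S\<^esub> s \<oplus>\<^bsub>S\<^esub> u" "a \<in> carrier R" "u \<in> N"
          using x F L unfolding adjoin_def by blast
        then have "a \<in> lead L" using x unfolding lead_def by blast
        then obtain v where v: "v \<in> N" "h a \<otimes>\<^bsub>S\<^esub> s \<oplus>\<^bsub>S\<^esub> v \<in> M"
          using leadL M(1) unfolding G_def lead_def by blast
        have c: "u \<in> carrier S" "v \<in> carrier S" using au v Nc by auto
        \<comment> \<open>Two elements with the same coefficient of \<open>s\<close> differ by an
          element of \<open>N\<close>; this difference lies in
          \<open>L \<inter> N = M \<inter> N\<close>, which brings \<open>x\<close> back into
          \<open>M\<close>.\<close>
        have eq: "u \<oplus>\<^bsub>S\<^esub> \<ominus>\<^bsub>S\<^esub> v = x \<oplus>\<^bsub>S\<^esub> \<ominus>\<^bsub>S\<^esub> (h a \<otimes>\<^bsub>S\<^esub> s \<oplus>\<^bsub>S\<^esub> v)"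
          unfolding au(1) using au(2) c s by (simp add: S.minus_add S.a_ac S.r_neg S.r_neg1 S.r_neg2)
        have "x \<oplus>\<^bsub>S\<^esub> \<ominus>\<^bsub>S\<^esub> (h a \<otimes>\<^bsub>S\<^esub> s \<oplus>\<^bsub>S\<^esub> v) \<in> L"
          by (rule submodD(3)[OF sL x submod_uminus[OF sL subsetD[OF L(2) v(2)]]])
        moreover have "u \<oplus>\<^bsub>S\<^esub> \<ominus>\<^bsub>S\<^esub> v \<in> N"
          by (rule submodD(3)[OF sN au(3) submod_uminus[OF sN v(1)]])
        ultimately have "u \<oplus>\<^bsub>S\<^esub> \<ominus>\<^bsub>S\<^esub> v \<in> M" using eq LN by auto
        moreover have "x = (h a \<otimes>\<^bsub>S\<^esub> s \<oplus>\<^bsub>S\<^esub> v) \<oplus>\<^bsub>S\<^esub> (u \<oplus>\<^bsub>S\<^esub> \<ominus>\<^bsub>S\<^esub> v)"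
          unfolding au(1) using au(2) c s by (simp add: S.a_ac S.r_neg S.r_neg1 S.r_neg2)
        ultimately show ?thesis using submodD(3)[OF sM v(2)] by simp
      qed
      then show "L = M" using L(2) by blast
    qed
  qed
qed

end

locale finite_extension = ring_hom_cring R S h for R (structure) and S (structure) and h +
  fixes J :: "'j set" and e :: "'j \<Rightarrow> 'c"
  assumes finite_basis: "finite J"
    and basis_closed: "e \<in> J \<rightarrow> carrier S"
    and basis_span: "s \<in> carrier S \<Longrightarrow> \<exists>c\<in>J \<rightarrow> carrier R. s = (\<Oplus>\<^bsub>S\<^esub>j\<in>J. h (c j) \<otimes>\<^bsub>S\<^esub> e j)"
    and noetherian_base: "noetherian_ring R"
begin

text \<open>The generators are adjoined one at a time. The induction only claims that some
  Noetherian submodule contains all combinations of the \<open>e j\<close> with \<open>j\<close> in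
  \<open>K\<close>; for \<open>K = J\<close> it must be all of \<open>S\<close>.\<close>

lemma noetherian_submod_carrier: "noetherian_submod (carrier S)"
proof -
  have "\<exists>N. noetherian_submod N \<and> (\<forall>c\<in>K \<rightarrow> carrier R. (\<Oplus>\<^bsub>S\<^esub>j\<in>K. h (c j) \<otimes>\<^bsub>S\<^esub> e j) \<in> N)"
    if "K \<subseteq> J" for K
    using finite_subset[OF that finite_basis] that
  proof (induction K)
    case empty
    have "noetherian_submod {\<zero>\<^bsub>S\<^esub>}"
      unfolding noetherian_submod_def
    proof (intro conjI allI impI)
      show "submod {\<zero>\<^bsub>S\<^esub>}" by (intro submodI) auto
      fix F assume F: "F \<noteq> {} \<and> (\<forall>M\<in>F. submod M \<and> M \<subseteq> {\<zero>\<^bsub>S\<^esub>})"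
      then have "M = {\<zero>\<^bsub>S\<^esub>}" if "M \<in> F" for M using submodD(2)[of M] that by blast
      then show "\<exists>M\<in>F. \<forall>L\<in>F. M \<subseteq> L \<longrightarrow> L = M" using F by blast
    qed
    then show ?case by auto
  next
    case (insert k K)
    then obtain N where N: "noetherian_submod N" "\<And>c. c \<in> K \<rightarrow> carrier R \<Longrightarrow> (\<Oplus>\<^bsub>S\<^esub>j\<in>K. h (c j) \<otimes>\<^bsub>S\<^esub> e j) \<in> N"
      by blast
    have ek: "e k \<in> carrier S" "e \<in> K \<rightarrow> carrier S" using insert basis_closed by auto
    have "(\<Oplus>\<^bsub>S\<^esub>j\<in>insert k K. h (c j) \<otimes>\<^bsub>S\<^esub> e j) \<in> adjoin (e k) N" if c: "c \<in> insert k K \<rightarrow> carrier R" for c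
    proof -
      have "(\<Oplus>\<^bsub>S\<^esub>j\<in>insert k K. h (c j) \<otimes>\<^bsub>S\<^esub> e j) = h (c k) \<otimes>\<^bsub>S\<^esub> e k \<oplus>\<^bsub>S\<^esub> (\<Oplus>\<^bsub>S\<^esub>j\<in>K. h (c j) \<otimes>\<^bsub>S\<^esub> e j)"
        using insert ek c by (intro S.finsum_insert) (auto simp: Pi_def)
      then show ?thesis unfolding adjoin_def using N(2)[of c] c by auto
    qed
    then show ?case using noetherian_submod_adjoin[OF noetherian_base N(1) ek(1)] by blast
  qed
  then obtain N where N: "noetherian_submod N" "\<And>c. c \<in> J \<rightarrow> carrier R \<Longrightarrow> (\<Oplus>\<^bsub>S\<^esub>j\<in>J. h (c j) \<otimes>\<^bsub>S\<^esub> e j) \<in> N"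
    using subset_refl by metis
  then have "carrier S \<subseteq> N" using basis_span by blast
  then have "N = carrier S" using N(1) by (auto simp: noetherian_submod_def submod_def)
  then show ?thesis using N(1) by simp
qed

lemma submod_chain_stabilizes:
  assumes "\<And>n::nat. submod (M n)" "\<And>n. M n \<subseteq> M (Suc n)"
  obtains n where "M (Suc n) = M n"
proof -
  have "\<exists>I\<in>range M. \<forall>L\<in>range M. I \<subseteq> L \<longrightarrow> L = I"
    using assms(1) submodD(1) by (intro noetherian_submodD[OF noetherian_submod_carrier]) auto
  then obtain n where n: "\<And>L. L \<in> range M \<Longrightarrow> M n \<subseteq> L \<Longrightarrow> L = M n" by blast
  show ?thesis by (rule that, rule n[OF rangeI assms(2)])
qed

text \<open>Ideals of \<open>S\<close> are submodules over \<open>R\<close>, so a chain of them has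
  a maximal member, which is then its union.\<close>

lemma noetherian_extension: "noetherian_ring S"
proof (rule S.trivial_ideal_chain_imp_noetherian)
  fix C assume C: "C \<noteq> {}" "subset.chain {I. ideal I S} C"
  have "\<exists>M\<in>C. \<forall>L\<in>C. M \<subseteq> L \<longrightarrow> L = M"
    using C ideal_submod submodD(1) unfolding pred_on.chain_def
    by (intro noetherian_submodD[OF noetherian_submod_carrier]) blast+
  then obtain M where M: "M \<in> C" "\<And>L. L \<in> C \<Longrightarrow> M \<subseteq> L \<Longrightarrow> L = M" by blast
  have "L \<subseteq> M" if "L \<in> C" for L
    using M(2)[OF that] C(2) that M(1) unfolding pred_on.chain_def by blast
  then have "\<Union>C = M" using M(1) by blast
  then show "\<Union>C \<in> C" using M by simp
qed

end

section \<open>Integrality, incomparability and contraction of maximal ideals\<close>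

context finite_extension
begin

text \<open>For an ideal \<open>Q\<close> these are the polynomials in \<open>s\<close> of degree
  less than \<open>n\<close> with coefficients from \<open>R\<close>, taken modulo \<open>Q\<close>
  and written in Horner form. Thus membership of the \<open>n\<close>-th power of \<open>s\<close>
  in \<open>power_span s Q n\<close> is a monic equation of degree \<open>n\<close> for
  \<open>s\<close> modulo \<open>Q\<close>; for \<open>n = 0\<close> it says that 1 lies in
  \<open>Q\<close>.\<close>

primrec power_span :: "'c \<Rightarrow> 'c set \<Rightarrow> nat \<Rightarrow> 'c set" where
  "power_span s Q 0 = Q"
| "power_span s Q (Suc n) =
     {h a \<oplus>\<^bsub>S\<^esub> (s \<otimes>\<^bsub>S\<^esub> m \<oplus>\<^bsub>S\<^esub> x) | a m x. a \<in> carrier R \<and> m \<in> power_span s Q n \<and> x \<in> Q}"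

lemma power_span_SucI:
  assumes "a \<in> carrier R" "m \<in> power_span s Q n" "x \<in> Q"
  shows "h a \<oplus>\<^bsub>S\<^esub> (s \<otimes>\<^bsub>S\<^esub> m \<oplus>\<^bsub>S\<^esub> x) \<in> power_span s Q (Suc n)"
  using assms by auto

lemma power_span_SucE:
  assumes "y \<in> power_span s Q (Suc n)"
  obtains a m x where "a \<in> carrier R" "m \<in> power_span s Q n" "x \<in> Q" "y = h a \<oplus>\<^bsub>S\<^esub> (s \<otimes>\<^bsub>S\<^esub> m \<oplus>\<^bsub>S\<^esub> x)"
  using assms by auto

declare power_span.simps(2) [simp del]

lemma submod_power_span:
  assumes Q: "ideal Q S" and s: "s \<in> carrier S"
  shows "submod (power_span s Q n)"
proof (induction n)
  case 0
  then show ?case using ideal_submod[OF Q] by simp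
next
  case (Suc n)
  note Qs = ideal_submod[OF Q]
  note c = subsetD[OF submodD(1)[OF Suc]] subsetD[OF submodD(1)[OF Qs]]
  show ?case
  proof (rule submodI)
    show "power_span s Q (Suc n) \<subseteq> carrier S"
      using s c by (auto elim!: power_span_SucE)
    have "\<zero>\<^bsub>S\<^esub> = h \<zero> \<oplus>\<^bsub>S\<^esub> (s \<otimes>\<^bsub>S\<^esub> \<zero>\<^bsub>S\<^esub> \<oplus>\<^bsub>S\<^esub> \<zero>\<^bsub>S\<^esub>)" using s by simp
    then show "\<zero>\<^bsub>S\<^esub> \<in> power_span s Q (Suc n)"
      using power_span_SucI[OF R.zero_closed submodD(2)[OF Suc] submodD(2)[OF Qs]] by simp
  next
    fix y z assume "y \<in> power_span s Q (Suc n)" "z \<in> power_span s Q (Suc n)"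
    then obtain a m x b l w where *: "a \<in> carrier R" "m \<in> power_span s Q n" "x \<in> Q"
      "b \<in> carrier R" "l \<in> power_span s Q n" "w \<in> Q"
      "y = h a \<oplus>\<^bsub>S\<^esub> (s \<otimes>\<^bsub>S\<^esub> m \<oplus>\<^bsub>S\<^esub> x)" "z = h b \<oplus>\<^bsub>S\<^esub> (s \<otimes>\<^bsub>S\<^esub> l \<oplus>\<^bsub>S\<^esub> w)"
      by (elim power_span_SucE)
    have "y \<oplus>\<^bsub>S\<^esub> z = h (a \<oplus> b) \<oplus>\<^bsub>S\<^esub> (s \<otimes>\<^bsub>S\<^esub> (m \<oplus>\<^bsub>S\<^esub> l) \<oplus>\<^bsub>S\<^esub> (x \<oplus>\<^bsub>S\<^esub> w))"
      using * s c by (simp add: S.r_distr S.a_ac)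
    then show "y \<oplus>\<^bsub>S\<^esub> z \<in> power_span s Q (Suc n)"
      using power_span_SucI[OF R.a_closed[OF *(1,4)] submodD(3)[OF Suc *(2,5)] submodD(3)[OF Qs *(3,6)]] by simp
  next
    fix r y assume r: "r \<in> carrier R" and "y \<in> power_span s Q (Suc n)"
    then obtain a m x where *: "a \<in> carrier R" "m \<in> power_span s Q n" "x \<in> Q"
      "y = h a \<oplus>\<^bsub>S\<^esub> (s \<otimes>\<^bsub>S\<^esub> m \<oplus>\<^bsub>S\<^esub> x)" by (elim power_span_SucE)
    have "h r \<otimes>\<^bsub>S\<^esub> y = h (r \<otimes> a) \<oplus>\<^bsub>S\<^esub> (s \<otimes>\<^bsub>S\<^esub> (h r \<otimes>\<^bsub>S\<^esub> m) \<oplus>\<^bsub>S\<^esub> h r \<otimes>\<^bsub>S\<^esub> x)"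
      using * s r c by (simp add: S.r_distr S.m_lcomm)
    then show "h r \<otimes>\<^bsub>S\<^esub> y \<in> power_span s Q (Suc n)"
      using power_span_SucI[OF R.m_closed[OF r *(1)] submodD(4)[OF Suc r *(2)] submodD(4)[OF Qs r *(3)]] by simp
  qed
qed

lemma power_span_mono:
  assumes Q: "ideal Q S" and s: "s \<in> carrier S"
  shows "power_span s Q n \<subseteq> power_span s Q (Suc n)"
proof (induction n)
  case 0
  interpret Q: ideal Q S by fact
  have "x \<in> power_span s Q (Suc 0)" if x: "x \<in> Q" for x
  proof -
    have "x = h \<zero> \<oplus>\<^bsub>S\<^esub> (s \<otimes>\<^bsub>S\<^esub> \<zero>\<^bsub>S\<^esub> \<oplus>\<^bsub>S\<^esub> x)" using s Q.Icarr[OF x] by simp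
    then show ?thesis
      using power_span_SucI[OF R.zero_closed _ x, of "\<zero>\<^bsub>S\<^esub>" s 0] Q.zero_closed by simp
  qed
  then show ?case by auto
next
  case (Suc n)
  show ?case
  proof
    fix y assume "y \<in> power_span s Q (Suc n)"
    then show "y \<in> power_span s Q (Suc (Suc n))"
      using Suc by (elim power_span_SucE) (auto intro!: power_span_SucI)
  qed
qed

text \<open>Integrality of \<open>s\<close> over \<open>R\<close>, modulo \<open>Q\<close>.\<close>

lemma power_in_power_span:
  assumes Q: "ideal Q S" and s: "s \<in> carrier S"
  obtains n where "s [^]\<^bsub>S\<^esub> n \<in> power_span s Q n"
proof -
  interpret Q: ideal Q S by fact
  \<comment> \<open>The \<open>n\<close>-th power is trivially a polynomial of degree less than
    \<open>n + 1\<close>; stabilisation of the ascending chain lowers this bound by one.\<close>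
  have "s [^]\<^bsub>S\<^esub> n \<in> power_span s Q (Suc n)" for n :: nat
  proof (induction n)
    case 0
    have "\<one>\<^bsub>S\<^esub> = h \<one> \<oplus>\<^bsub>S\<^esub> (s \<otimes>\<^bsub>S\<^esub> \<zero>\<^bsub>S\<^esub> \<oplus>\<^bsub>S\<^esub> \<zero>\<^bsub>S\<^esub>)" using s by simp
    then show ?case
      using power_span_SucI[OF R.one_closed _ Q.zero_closed, of "\<zero>\<^bsub>S\<^esub>" s 0] Q.zero_closed by simp
  next
    case (Suc n)
    have "s [^]\<^bsub>S\<^esub> Suc n = h \<zero> \<oplus>\<^bsub>S\<^esub> (s \<otimes>\<^bsub>S\<^esub> s [^]\<^bsub>S\<^esub> n \<oplus>\<^bsub>S\<^esub> \<zero>\<^bsub>S\<^esub>)" using s by (simp add: S.m_comm)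
    then show ?case using power_span_SucI[OF R.zero_closed Suc Q.zero_closed] by simp
  qed
  moreover obtain n where "power_span s Q (Suc n) = power_span s Q n"
    using submod_chain_stabilizes[of "power_span s Q"] submod_power_span[OF assms] power_span_mono[OF assms] by blast
  ultimately show ?thesis using that by blast
qed

definition contraction :: "'c set \<Rightarrow> 'a set" where
  "contraction P = {r \<in> carrier R. h r \<in> P}"

lemma ideal_contraction:
  assumes "ideal P S"
  shows "ideal (contraction P) R"
proof -
  interpret P: ideal P S by fact
  show ?thesis
    by (rule R.cring_idealI) (auto simp: contraction_def intro: P.I_l_closed)
qed

lemma primeideal_contraction:
  assumes "primeideal P S"
  shows "primeideal (contraction P) R"
proof -
  interpret P: primeideal P S by fact
  show ?thesis
  proof (rule primeidealI[OF ideal_contraction[OF P.ideal_axioms] R.is_cring])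
    have "\<one>\<^bsub>S\<^esub> \<notin> P" using P.one_imp_carrier P.I_notcarr by auto
    then have "\<one> \<notin> contraction P" by (simp add: contraction_def)
    then show "carrier R \<noteq> contraction P" using R.one_closed by blast
    show "a \<in> contraction P \<or> b \<in> contraction P"
      if "a \<in> carrier R" "b \<in> carrier R" "a \<otimes> b \<in> contraction P" for a b
      using that P.I_prime[of "h a" "h b"] by (auto simp: contraction_def)
  qed
qed

text \<open>Take \<open>s\<close> in \<open>Q'\<close> outside \<open>Q\<close> and suppose that the
  contractions agree. In a monic equation for \<open>s\<close> modulo \<open>Q\<close> the constant
  term lies in \<open>Q'\<close>, hence in \<open>Q\<close>; then \<open>s\<close> divides the rest
  and is cancelled because \<open>Q\<close> is prime. Each such step lowers the degree, and degree 0
  would put 1 into \<open>Q\<close>.\<close>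

lemma incomparability:
  assumes Q: "primeideal Q S" and Q': "ideal Q' S" and sub: "Q \<subset> Q'"
  shows "contraction Q \<subset> contraction Q'"
proof (rule ccontr)
  assume "\<not> contraction Q \<subset> contraction Q'"
  then have eq: "contraction Q' = contraction Q" using sub unfolding contraction_def by blast
  interpret Q: primeideal Q S by fact
  interpret Q': ideal Q' S by fact
  obtain s where s: "s \<in> Q'" "s \<notin> Q" using sub by blast
  then have sc: "s \<in> carrier S" using Q'.Icarr by blast
  have "s [^]\<^bsub>S\<^esub> n \<notin> power_span s Q n" for n
  proof (induction n)
    case 0
    then show ?case using Q.one_imp_carrier Q.I_notcarr by auto
  next
    case (Suc n)
    show ?case
    proof
      assume "s [^]\<^bsub>S\<^esub> Suc n \<in> power_span s Q (Suc n)"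
      then obtain a m x where *: "a \<in> carrier R" "m \<in> power_span s Q n" "x \<in> Q"
        "s [^]\<^bsub>S\<^esub> Suc n = h a \<oplus>\<^bsub>S\<^esub> (s \<otimes>\<^bsub>S\<^esub> m \<oplus>\<^bsub>S\<^esub> x)" by (elim power_span_SucE)
      note sm = submod_power_span[OF Q.ideal_axioms sc, of n]
      have c: "m \<in> carrier S" "x \<in> carrier S" "h a \<in> carrier S" "s [^]\<^bsub>S\<^esub> n \<in> carrier S"
        using submodD(1)[OF sm] * sc Q.Icarr by auto
      \<comment> \<open>\<open>d\<close> is the relation divided by \<open>s\<close>: modulo
        \<open>Q\<close>, the product of \<open>s\<close> and \<open>d\<close> equals the constant
        term \<open>h a\<close>.\<close>
      define d where "d = s [^]\<^bsub>S\<^esub> n \<ominus>\<^bsub>S\<^esub> m"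
      have dc: "d \<in> carrier S" using c by (simp add: d_def)
      have pn: "s [^]\<^bsub>S\<^esub> n = d \<oplus>\<^bsub>S\<^esub> m" using c unfolding d_def by algebra
      have "(d \<oplus>\<^bsub>S\<^esub> m) \<otimes>\<^bsub>S\<^esub> s = h a \<oplus>\<^bsub>S\<^esub> (s \<otimes>\<^bsub>S\<^esub> m \<oplus>\<^bsub>S\<^esub> x)" using *(4) pn by simp
      moreover have "h a = (h a \<oplus>\<^bsub>S\<^esub> (s \<otimes>\<^bsub>S\<^esub> m \<oplus>\<^bsub>S\<^esub> x)) \<ominus>\<^bsub>S\<^esub> (s \<otimes>\<^bsub>S\<^esub> m \<oplus>\<^bsub>S\<^esub> x)"
        using c sc by algebra
      ultimately have "h a = (d \<oplus>\<^bsub>S\<^esub> m) \<otimes>\<^bsub>S\<^esub> s \<ominus>\<^bsub>S\<^esub> (s \<otimes>\<^bsub>S\<^esub> m \<oplus>\<^bsub>S\<^esub> x)" by simp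
      also have "\<dots> = s \<otimes>\<^bsub>S\<^esub> d \<ominus>\<^bsub>S\<^esub> x" using c sc dc by algebra
      finally have ha: "h a = s \<otimes>\<^bsub>S\<^esub> d \<ominus>\<^bsub>S\<^esub> x" .
      have "x \<in> Q'" using *(3) sub by blast
      then have "s \<otimes>\<^bsub>S\<^esub> d \<ominus>\<^bsub>S\<^esub> x \<in> Q'"
        unfolding a_minus_def using s dc by (intro Q'.a_closed Q'.a_inv_closed Q'.I_r_closed)
      then have "a \<in> contraction Q'" using ha *(1) unfolding contraction_def by simp
      then have "h a \<in> Q" using eq unfolding contraction_def by blast
      then have "h a \<oplus>\<^bsub>S\<^esub> x \<in> Q" using *(3) by (rule Q.a_closed)
      moreover have "h a \<oplus>\<^bsub>S\<^esub> x = s \<otimes>\<^bsub>S\<^esub> d" unfolding ha using sc dc c by algebra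
      ultimately have "d \<in> Q" using Q.I_prime[OF sc dc] s by auto
      moreover have "Q \<subseteq> power_span s Q n"
        using lift_Suc_mono_le[of "power_span s Q" 0 n] power_span_mono[OF Q.ideal_axioms sc] by simp
      ultimately have "s [^]\<^bsub>S\<^esub> n \<in> power_span s Q n" unfolding pn using submodD(3)[OF sm] *(2) by blast
      then show False using Suc by blast
    qed
  qed
  then show False using power_in_power_span[OF Q.ideal_axioms sc] by blast
qed

text \<open>Modulo \<open>P\<close>, \<open>h a\<close> is inverse to \<open>s\<close>. An element
  of \<open>power_span s P n\<close> involves \<open>s\<close> only with exponents below
  \<open>n\<close>, so the \<open>n\<close>-th power of \<open>h a\<close> absorbs every power of
  \<open>s\<close> and leaves at least one factor \<open>h a\<close>.\<close>

lemma power_span_reduce: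
  assumes P: "ideal P S" and a: "a \<in> carrier R" and s: "s \<in> carrier S" and x: "x \<in> P"
    and as: "h a \<otimes>\<^bsub>S\<^esub> s = \<one>\<^bsub>S\<^esub> \<ominus>\<^bsub>S\<^esub> x"
  shows "m \<in> power_span s P n \<Longrightarrow> \<exists>c\<in>carrier R. \<exists>y\<in>P. h a [^]\<^bsub>S\<^esub> n \<otimes>\<^bsub>S\<^esub> m = h (a \<otimes> c) \<oplus>\<^bsub>S\<^esub> y"
proof (induction n arbitrary: m)
  interpret P: ideal P S by fact
  {
    case 0
    then have "h a [^]\<^bsub>S\<^esub> (0::nat) \<otimes>\<^bsub>S\<^esub> m = h (a \<otimes> \<zero>) \<oplus>\<^bsub>S\<^esub> m" using a P.Icarr by simp
    then show ?case using 0 by (intro bexI[of _ \<zero>] bexI[of _ m]) auto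
  next
    case (Suc n)
    obtain b l w where m: "b \<in> carrier R" "l \<in> power_span s P n" "w \<in> P"
      "m = h b \<oplus>\<^bsub>S\<^esub> (s \<otimes>\<^bsub>S\<^esub> l \<oplus>\<^bsub>S\<^esub> w)" using Suc.prems by (rule power_span_SucE)
    obtain c y where cy: "c \<in> carrier R" "y \<in> P" "h a [^]\<^bsub>S\<^esub> n \<otimes>\<^bsub>S\<^esub> l = h (a \<otimes> c) \<oplus>\<^bsub>S\<^esub> y"
      using Suc.IH[OF m(2)] by blast
    have l: "l \<in> carrier S" using submodD(1)[OF submod_power_span[OF P s]] m(2) by (rule subsetD)
    have c: "y \<in> carrier S" "w \<in> carrier S" "h b \<in> carrier S" "h c \<in> carrier S" "h a \<in> carrier S" "x \<in> carrier S"
      using m cy a x P.Icarr by simp_all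
    have A: "h a [^]\<^bsub>S\<^esub> n = h (a [^] n)" using a by (induction n) simp_all
    define A where "A = h (a [^] n)"
    have Ac: "A \<in> carrier S" using a by (simp add: A_def)
    define z where "z = (h a \<otimes>\<^bsub>S\<^esub> A) \<otimes>\<^bsub>S\<^esub> w \<oplus>\<^bsub>S\<^esub> (y \<ominus>\<^bsub>S\<^esub> (h a \<otimes>\<^bsub>S\<^esub> h c \<oplus>\<^bsub>S\<^esub> y) \<otimes>\<^bsub>S\<^esub> x)"
    have "(h a \<otimes>\<^bsub>S\<^esub> A) \<otimes>\<^bsub>S\<^esub> w \<in> P" using m(3) by (rule P.I_l_closed) (use c Ac in simp)
    moreover have "(h a \<otimes>\<^bsub>S\<^esub> h c \<oplus>\<^bsub>S\<^esub> y) \<otimes>\<^bsub>S\<^esub> x \<in> P" using x by (rule P.I_l_closed) (use c in simp)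
    ultimately have z: "z \<in> P"
      unfolding z_def a_minus_def using cy(2) by (intro P.a_closed P.a_inv_closed)
    have "h a [^]\<^bsub>S\<^esub> Suc n \<otimes>\<^bsub>S\<^esub> m = A \<otimes>\<^bsub>S\<^esub> h a \<otimes>\<^bsub>S\<^esub> (h b \<oplus>\<^bsub>S\<^esub> (s \<otimes>\<^bsub>S\<^esub> l \<oplus>\<^bsub>S\<^esub> w))"
      unfolding m(4) A_def A[symmetric] by simp
    also have "\<dots> = h a \<otimes>\<^bsub>S\<^esub> A \<otimes>\<^bsub>S\<^esub> h b \<oplus>\<^bsub>S\<^esub> (h a \<otimes>\<^bsub>S\<^esub> s) \<otimes>\<^bsub>S\<^esub> (A \<otimes>\<^bsub>S\<^esub> l) \<oplus>\<^bsub>S\<^esub> h a \<otimes>\<^bsub>S\<^esub> A \<otimes>\<^bsub>S\<^esub> w"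
      using Ac l c s by algebra
    also have "A \<otimes>\<^bsub>S\<^esub> l = h a \<otimes>\<^bsub>S\<^esub> h c \<oplus>\<^bsub>S\<^esub> y"
      using cy a unfolding A_def A[symmetric] by simp
    also have "h a \<otimes>\<^bsub>S\<^esub> A \<otimes>\<^bsub>S\<^esub> h b \<oplus>\<^bsub>S\<^esub> (h a \<otimes>\<^bsub>S\<^esub> s) \<otimes>\<^bsub>S\<^esub> (h a \<otimes>\<^bsub>S\<^esub> h c \<oplus>\<^bsub>S\<^esub> y) \<oplus>\<^bsub>S\<^esub> h a \<otimes>\<^bsub>S\<^esub> A \<otimes>\<^bsub>S\<^esub> w
        = h a \<otimes>\<^bsub>S\<^esub> (A \<otimes>\<^bsub>S\<^esub> h b \<oplus>\<^bsub>S\<^esub> h c) \<oplus>\<^bsub>S\<^esub> z"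
      unfolding z_def as using Ac c by algebra
    also have "h a \<otimes>\<^bsub>S\<^esub> (A \<otimes>\<^bsub>S\<^esub> h b \<oplus>\<^bsub>S\<^esub> h c) = h (a \<otimes> (a [^] n \<otimes> b \<oplus> c))"
      using a m(1) cy(1) by (simp add: A_def)
    finally show ?case using z a m(1) cy(1) by (intro bexI[of _ "a [^] n \<otimes> b \<oplus> c"] bexI[of _ z]) simp_all
  }
qed

lemma power_mult_power_reduce:
  assumes P: "ideal P S" and a: "a \<in> carrier R" and s: "s \<in> carrier S" and x: "x \<in> P"
    and as: "h a \<otimes>\<^bsub>S\<^esub> s = \<one>\<^bsub>S\<^esub> \<ominus>\<^bsub>S\<^esub> x"
  shows "\<exists>y\<in>P. h a [^]\<^bsub>S\<^esub> (n::nat) \<otimes>\<^bsub>S\<^esub> s [^]\<^bsub>S\<^esub> n = \<one>\<^bsub>S\<^esub> \<oplus>\<^bsub>S\<^esub> y"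
proof (induction n)
  interpret P: ideal P S by fact
  {
    case 0
    then show ?case using P.zero_closed by (intro bexI[of _ "\<zero>\<^bsub>S\<^esub>"]) auto
  next
    case (Suc n)
    then obtain y where y: "y \<in> P" "h a [^]\<^bsub>S\<^esub> n \<otimes>\<^bsub>S\<^esub> s [^]\<^bsub>S\<^esub> n = \<one>\<^bsub>S\<^esub> \<oplus>\<^bsub>S\<^esub> y" by blast
    have c: "y \<in> carrier S" "x \<in> carrier S" "h a \<in> carrier S" using y x a P.Icarr by simp_all
    define z where "z = y \<ominus>\<^bsub>S\<^esub> (\<one>\<^bsub>S\<^esub> \<oplus>\<^bsub>S\<^esub> y) \<otimes>\<^bsub>S\<^esub> x"
    have "(\<one>\<^bsub>S\<^esub> \<oplus>\<^bsub>S\<^esub> y) \<otimes>\<^bsub>S\<^esub> x \<in> P" using x by (rule P.I_l_closed) (use c in simp)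
    then have z: "z \<in> P" unfolding z_def a_minus_def using y(1) by (intro P.a_closed P.a_inv_closed)
    have "h a [^]\<^bsub>S\<^esub> Suc n \<otimes>\<^bsub>S\<^esub> s [^]\<^bsub>S\<^esub> Suc n = (h a [^]\<^bsub>S\<^esub> n \<otimes>\<^bsub>S\<^esub> s [^]\<^bsub>S\<^esub> n) \<otimes>\<^bsub>S\<^esub> (h a \<otimes>\<^bsub>S\<^esub> s)"
      using c s by (simp add: S.m_ac)
    also have "\<dots> = \<one>\<^bsub>S\<^esub> \<oplus>\<^bsub>S\<^esub> z"
      unfolding y(2) as z_def using c by algebra
    finally show ?case using z by blast
  }
qed

text \<open>For \<open>a\<close> outside the contraction, \<open>h a\<close> has an inverse
  \<open>s\<close> modulo \<open>P\<close>. Multiplying a monic equation of degree \<open>n\<close>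
  for \<open>s\<close> by the \<open>n\<close>-th power of \<open>h a\<close> turns its left side
  into 1 and its right side into some \<open>h (a \<otimes> c)\<close> modulo \<open>P\<close>, so
  \<open>a\<close> is already invertible modulo the contraction.\<close>

lemma maximalideal_contraction:
  assumes P: "maximalideal P S"
  shows "maximalideal (contraction P) R"
proof -
  interpret P: maximalideal P S by fact
  have prime: "primeideal P S" using S.maximalideal_prime[OF P] .
  interpret p: primeideal "contraction P" R using primeideal_contraction[OF prime] .
  show ?thesis
  proof (rule maximalidealI[OF p.ideal_axioms p.I_notcarr])
    fix I assume I: "ideal I R" "contraction P \<subseteq> I" "I \<subseteq> carrier R"
    interpret I: ideal I R by fact
    show "I = contraction P \<or> I = carrier R"
    proof (rule ccontr)
      assume "\<not> (I = contraction P \<or> I = carrier R)"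
      then have "I \<noteq> carrier R" and "\<exists>a. a \<in> I \<and> a \<notin> contraction P" using I by blast+
      then obtain a where a: "a \<in> I" "a \<in> carrier R" "h a \<notin> P"
        unfolding contraction_def using I.Icarr by blast
      define K where "K = set_add S P (PIdl\<^bsub>S\<^esub> (h a))"
      have K: "ideal K S" unfolding K_def
        using S.add_ideals[OF P.ideal_axioms S.cgenideal_ideal] a by simp
      have "P \<subseteq> K"
      proof
        fix x assume x: "x \<in> P"
        then have "x = x \<oplus>\<^bsub>S\<^esub> \<zero>\<^bsub>S\<^esub>" using P.Icarr by simp
        moreover have "\<zero>\<^bsub>S\<^esub> \<in> PIdl\<^bsub>S\<^esub> (h a)"
          using S.cgenideal_ideal[of "h a"] a by (auto intro: additive_subgroup.zero_closed ideal.axioms)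
        ultimately show "x \<in> K" unfolding K_def set_add_def' using x by blast
      qed
      moreover have "h a \<in> K"
      proof -
        have "h a = \<zero>\<^bsub>S\<^esub> \<oplus>\<^bsub>S\<^esub> h a" using a by simp
        then show ?thesis unfolding K_def set_add_def'
          using S.cgenideal_self[of "h a"] a P.zero_closed by blast
      qed
      moreover have "K \<subseteq> carrier S" using ideal.Icarr[OF K] by blast
      ultimately have "K = carrier S" using P.I_maximal[OF K] a by blast
      then have "\<one>\<^bsub>S\<^esub> \<in> K" by simp
      then obtain x s where xs: "x \<in> P" "s \<in> carrier S" "\<one>\<^bsub>S\<^esub> = x \<oplus>\<^bsub>S\<^esub> s \<otimes>\<^bsub>S\<^esub> h a"
        unfolding K_def set_add_def' cgenideal_def by blast
      have xc: "x \<in> carrier S" "h a \<in> carrier S" using xs P.Icarr a by auto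
      have as: "h a \<otimes>\<^bsub>S\<^esub> s = \<one>\<^bsub>S\<^esub> \<ominus>\<^bsub>S\<^esub> x" unfolding xs(3) using xs(2) xc by algebra
      note reduce = power_span_reduce[OF P.ideal_axioms a(2) xs(2,1) as]
      note one = power_mult_power_reduce[OF P.ideal_axioms a(2) xs(2,1) as]
      obtain n where "s [^]\<^bsub>S\<^esub> n \<in> power_span s P n" using power_in_power_span[OF P.ideal_axioms xs(2)] .
      then obtain c y z where cyz: "c \<in> carrier R" "y \<in> P" "z \<in> P"
        "h (a \<otimes> c) \<oplus>\<^bsub>S\<^esub> y = \<one>\<^bsub>S\<^esub> \<oplus>\<^bsub>S\<^esub> z" using reduce one[of n] by metis
      have yz: "y \<in> carrier S" "z \<in> carrier S" "h (a \<otimes> c) \<in> carrier S" using cyz P.Icarr a by auto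
      have "h (\<one> \<ominus> a \<otimes> c) = \<one>\<^bsub>S\<^esub> \<ominus>\<^bsub>S\<^esub> h (a \<otimes> c)" using a cyz(1) by (simp add: a_minus_def)
      also have "\<dots> = (\<one>\<^bsub>S\<^esub> \<oplus>\<^bsub>S\<^esub> z) \<ominus>\<^bsub>S\<^esub> h (a \<otimes> c) \<ominus>\<^bsub>S\<^esub> z" using yz by algebra
      also have "\<dots> = y \<ominus>\<^bsub>S\<^esub> z" unfolding cyz(4)[symmetric] using yz by algebra
      also have "\<dots> \<in> P" unfolding a_minus_def using cyz by (intro P.a_closed P.a_inv_closed)
      finally have "h (\<one> \<ominus> a \<otimes> c) \<in> P" .
      moreover have "\<one> \<ominus> a \<otimes> c \<in> carrier R" using a(2) cyz(1) by simp
      ultimately have "\<one> \<ominus> a \<otimes> c \<in> I" using I(2) unfolding contraction_def by blast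
      then have "(\<one> \<ominus> a \<otimes> c) \<oplus> a \<otimes> c \<in> I" using I.I_r_closed[OF a(1) cyz(1)] by (rule I.a_closed)
      moreover have "(\<one> \<ominus> a \<otimes> c) \<oplus> a \<otimes> c = \<one>" using a(2) cyz(1) by algebra
      ultimately show False using I.one_imp_carrier \<open>I \<noteq> carrier R\<close> by simp
    qed
  qed
qed

lemma prime_height_contraction: "prime_height S P \<le> prime_height R (contraction P)"
  unfolding prime_height_def[of S]
proof (rule Sup_least)
  fix l assume "l \<in> {enat n |n. \<exists>Q. (\<forall>i\<le>n. primeideal (Q i) S) \<and> (\<forall>i<n. Q i \<subset> Q (Suc i)) \<and> Q n = P}"
  then obtain n Q where l: "l = enat n"
    and Q: "\<forall>i\<le>n. primeideal (Q i) S" "\<forall>i<n. Q i \<subset> Q (Suc i)" "Q n = P" by blast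
  define Q' where "Q' = (\<lambda>i. contraction (Q i))"
  have 1: "\<forall>i\<le>n. primeideal (Q' i) R" unfolding Q'_def using Q(1) primeideal_contraction by blast
  have 2: "\<forall>i<n. Q' i \<subset> Q' (Suc i)"
  proof (intro allI impI)
    fix i assume i: "i < n"
    have "primeideal (Q i) S" "primeideal (Q (Suc i)) S" using Q(1) i by simp_all
    then show "Q' i \<subset> Q' (Suc i)"
      unfolding Q'_def using Q(2) i by (intro incomparability primeideal.axioms(1)) simp_all
  qed
  have "Q' n = contraction P" using Q(3) by (simp add: Q'_def)
  then show "l \<le> prime_height R (contraction P)"
    unfolding prime_height_def l using 1 2 by (intro Sup_upper) blast
qed

end

section \<open>Finite free extensions and regular sequences\<close>

locale finite_free_extension = finite_extension +
  assumes basis_indep: "c \<in> J \<rightarrow> carrier R \<Longrightarrow> (\<Oplus>\<^bsub>S\<^esub>j\<in>J. h (c j) \<otimes>\<^bsub>S\<^esub> e j) = \<zero>\<^bsub>S\<^esub> \<Longrightarrow> j \<in> J \<Longrightarrow> c j = \<zero>"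
begin

definition combination :: "('e \<Rightarrow> 'a) \<Rightarrow> 'c" where
  "combination c = (\<Oplus>\<^bsub>S\<^esub>j\<in>J. h (c j) \<otimes>\<^bsub>S\<^esub> e j)"

lemma combination_closed: "c \<in> J \<rightarrow> carrier R \<Longrightarrow> combination c \<in> carrier S"
  unfolding combination_def using basis_closed by (intro S.finsum_closed) (auto simp: Pi_def)

lemma combination_zero: "combination (\<lambda>_. \<zero>) = \<zero>\<^bsub>S\<^esub>"
  unfolding combination_def using basis_closed by (intro S.add.finprod_one_eqI) (auto simp: Pi_def)

lemma combination_add:
  assumes "c \<in> J \<rightarrow> carrier R" "d \<in> J \<rightarrow> carrier R"
  shows "combination c \<oplus>\<^bsub>S\<^esub> combination d = combination (\<lambda>j. c j \<oplus> d j)"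
proof -
  have "combination c \<oplus>\<^bsub>S\<^esub> combination d = (\<Oplus>\<^bsub>S\<^esub>j\<in>J. h (c j) \<otimes>\<^bsub>S\<^esub> e j \<oplus>\<^bsub>S\<^esub> h (d j) \<otimes>\<^bsub>S\<^esub> e j)"
    unfolding combination_def using assms basis_closed by (intro S.finsum_addf[symmetric]) (auto simp: Pi_def)
  also have "\<dots> = combination (\<lambda>j. c j \<oplus> d j)"
    unfolding combination_def using assms basis_closed by (intro S.finsum_cong') (auto simp: Pi_def S.l_distr)
  finally show ?thesis .
qed

lemma combination_mult:
  assumes "a \<in> carrier R" "c \<in> J \<rightarrow> carrier R"
  shows "h a \<otimes>\<^bsub>S\<^esub> combination c = combination (\<lambda>j. a \<otimes> c j)"
proof -
  have "h a \<otimes>\<^bsub>S\<^esub> combination c = (\<Oplus>\<^bsub>S\<^esub>j\<in>J. h a \<otimes>\<^bsub>S\<^esub> (h (c j) \<otimes>\<^bsub>S\<^esub> e j))"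
    unfolding combination_def using assms basis_closed finite_basis by (intro S.finsum_rdistr) (auto simp: Pi_def)
  also have "\<dots> = combination (\<lambda>j. a \<otimes> c j)"
    unfolding combination_def using assms basis_closed by (intro S.finsum_cong') (auto simp: Pi_def S.m_assoc)
  finally show ?thesis .
qed

lemma combination_inject:
  assumes c: "c \<in> J \<rightarrow> carrier R" and d: "d \<in> J \<rightarrow> carrier R" and eq: "combination c = combination d" and j: "j \<in> J"
  shows "c j = d j"
proof -
  have nd: "(\<lambda>j. (\<ominus> \<one>) \<otimes> d j) \<in> J \<rightarrow> carrier R" using d by auto
  have "combination (\<lambda>j. c j \<oplus> (\<ominus> \<one>) \<otimes> d j) = combination c \<oplus>\<^bsub>S\<^esub> h (\<ominus> \<one>) \<otimes>\<^bsub>S\<^esub> combination d"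
    using combination_add[OF c nd] combination_mult[OF _ d, of "\<ominus> \<one>"] by simp
  also have "\<dots> = \<zero>\<^bsub>S\<^esub>" unfolding eq using combination_closed[OF d] by (simp add: S.l_minus S.r_neg)
  finally have "c j \<oplus> (\<ominus> \<one>) \<otimes> d j = \<zero>"
    using c nd j unfolding combination_def
    by (intro basis_indep[where c = "\<lambda>j. c j \<oplus> (\<ominus> \<one>) \<otimes> d j"]) auto
  moreover have "c j \<in> carrier R" "d j \<in> carrier R" using c d j by auto
  ultimately show ?thesis by (simp add: R.l_minus flip: R.minus_eq)
qed

text \<open>These combinations form the extension of \<open>I\<close> to \<open>S\<close>.
  Multiplication by \<open>s\<close> mixes the coordinates, but when the product of \<open>s\<close>
  and \<open>e k\<close> is expanded in the basis, the factor \<open>c k\<close> keeps all new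
  coefficients in \<open>I\<close>.\<close>

lemma ideal_combinations:
  assumes I: "ideal I R"
  shows "ideal (combination ` (J \<rightarrow> I)) S"
proof -
  interpret I: ideal I R by fact
  have IR: "c \<in> J \<rightarrow> carrier R" if "c \<in> J \<rightarrow> I" for c :: "'e \<Rightarrow> 'a" using that I.Icarr by (simp add: Pi_iff)
  define E where "E = combination ` (J \<rightarrow> I)"
  have zero: "\<zero>\<^bsub>S\<^esub> \<in> E"
    unfolding E_def using combination_zero I.zero_closed by (intro image_eqI[of _ _ "\<lambda>_. \<zero>"]) auto
  have add: "x \<oplus>\<^bsub>S\<^esub> y \<in> E" if xy: "x \<in> E" "y \<in> E" for x y
  proof -
    obtain c d where *: "c \<in> J \<rightarrow> I" "d \<in> J \<rightarrow> I" "x = combination c" "y = combination d"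
      using xy unfolding E_def by blast
    then have "x \<oplus>\<^bsub>S\<^esub> y = combination (\<lambda>j. c j \<oplus> d j)"
      using combination_add[OF IR IR] by blast
    moreover have "(\<lambda>j. c j \<oplus> d j) \<in> J \<rightarrow> I" using * by auto
    ultimately show ?thesis unfolding E_def by blast
  qed
  have scale: "h a \<otimes>\<^bsub>S\<^esub> t \<in> E" if at: "a \<in> I" "t \<in> carrier S" for a t
  proof -
    obtain d where d: "d \<in> J \<rightarrow> carrier R" "t = combination d"
      using basis_span[OF at(2)] unfolding combination_def by blast
    have "h a \<otimes>\<^bsub>S\<^esub> t = combination (\<lambda>j. a \<otimes> d j)" 
      unfolding d(2) by (rule combination_mult[OF I.Icarr[OF at(1)] d(1)])
    moreover have "(\<lambda>j. a \<otimes> d j) \<in> J \<rightarrow> I" using d at I.I_r_closed by auto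
    ultimately show ?thesis unfolding E_def by blast
  qed
  have "s \<otimes>\<^bsub>S\<^esub> combination c \<in> E" if s: "s \<in> carrier S" and c: "c \<in> J \<rightarrow> I" for s c
  proof -
    have "(\<Oplus>\<^bsub>S\<^esub>j\<in>K. s \<otimes>\<^bsub>S\<^esub> (h (c j) \<otimes>\<^bsub>S\<^esub> e j)) \<in> E" if "K \<subseteq> J" for K
      using finite_subset[OF that finite_basis] that
    proof (induction K)
      case empty
      then show ?case using zero by simp
    next
      case (insert k K)
      have ek: "e k \<in> carrier S" "c k \<in> I" "\<And>j. j \<in> K \<Longrightarrow> e j \<in> carrier S \<and> c j \<in> carrier R"
        using insert basis_closed c IR[OF c] by auto
      have "(\<Oplus>\<^bsub>S\<^esub>j\<in>insert k K. s \<otimes>\<^bsub>S\<^esub> (h (c j) \<otimes>\<^bsub>S\<^esub> e j))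
          = s \<otimes>\<^bsub>S\<^esub> (h (c k) \<otimes>\<^bsub>S\<^esub> e k) \<oplus>\<^bsub>S\<^esub> (\<Oplus>\<^bsub>S\<^esub>j\<in>K. s \<otimes>\<^bsub>S\<^esub> (h (c j) \<otimes>\<^bsub>S\<^esub> e j))"
        using insert.hyps ek s I.Icarr by (intro S.finsum_insert) (auto simp: Pi_def)
      moreover have "s \<otimes>\<^bsub>S\<^esub> (h (c k) \<otimes>\<^bsub>S\<^esub> e k) = h (c k) \<otimes>\<^bsub>S\<^esub> (s \<otimes>\<^bsub>S\<^esub> e k)"
        using ek s I.Icarr by (simp add: S.m_lcomm)
      ultimately show ?case using add scale[OF ek(2), of "s \<otimes>\<^bsub>S\<^esub> e k"] s ek insert by simp
    qed
    from this[OF subset_refl] show ?thesis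
      unfolding combination_def using s c basis_closed I.Icarr finite_basis
      by (subst S.finsum_rdistr) (auto simp: Pi_def)
  qed
  then have mult: "s \<otimes>\<^bsub>S\<^esub> x \<in> E" if "s \<in> carrier S" "x \<in> E" for s x
    using that unfolding E_def by blast
  have "E \<subseteq> carrier S" unfolding E_def using combination_closed[OF IR] by blast
  then have "ideal E S" using zero add mult by (rule S.cring_idealI)
  then show ?thesis by (simp add: E_def)
qed

text \<open>Freeness makes membership in an extended ideal a coordinatewise condition:
  \<open>S\<close> modulo the extension is a direct sum of copies of \<open>R\<close> modulo the
  ideal. Uniqueness of coordinates enters through \<open>combination_inject\<close>.\<close>

lemma genideal_image:
  assumes T: "T \<subseteq> carrier R" and c: "c \<in> J \<rightarrow> carrier R"
  shows "combination c \<in> Idl\<^bsub>S\<^esub> (h ` T) \<longleftrightarrow> c \<in> J \<rightarrow> Idl T"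
proof
  interpret I: ideal "Idl T" R using T by (rule R.genideal_ideal)
  assume "combination c \<in> Idl\<^bsub>S\<^esub> (h ` T)"
  moreover have "Idl\<^bsub>S\<^esub> (h ` T) \<subseteq> combination ` (J \<rightarrow> Idl T)"
  proof (rule S.genideal_minimal[OF ideal_combinations[OF I.ideal_axioms]], safe)
    fix t assume t: "t \<in> T"
    obtain d where d: "d \<in> J \<rightarrow> carrier R" "\<one>\<^bsub>S\<^esub> = combination d"
      using basis_span[OF S.one_closed] unfolding combination_def by blast
    have tc: "t \<in> carrier R" "t \<in> Idl T" using t T R.genideal_self[OF T] by auto
    have "h t = h t \<otimes>\<^bsub>S\<^esub> \<one>\<^bsub>S\<^esub>" using tc by simp
    also have "\<dots> = combination (\<lambda>j. t \<otimes> d j)" unfolding d(2) by (rule combination_mult[OF tc(1) d(1)])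
    finally show "h t \<in> combination ` (J \<rightarrow> Idl T)" using d(1) tc I.I_r_closed by auto
  qed
  ultimately obtain d where d: "d \<in> J \<rightarrow> Idl T" "combination c = combination d" by blast
  then have "d \<in> J \<rightarrow> carrier R" using I.Icarr by (simp add: Pi_iff)
  then have "c j = d j" if "j \<in> J" for j using combination_inject[OF c _ d(2) that] by blast
  then show "c \<in> J \<rightarrow> Idl T" using d(1) by auto
next
  assume cI: "c \<in> J \<rightarrow> Idl T"
  have hT: "h ` T \<subseteq> carrier S" using T by auto
  interpret E: ideal "Idl\<^bsub>S\<^esub> (h ` T)" S using hT by (rule S.genideal_ideal)
  have "Idl T \<subseteq> contraction (Idl\<^bsub>S\<^esub> (h ` T))"
    using T S.genideal_self[OF hT]
    by (intro R.genideal_minimal ideal_contraction E.ideal_axioms) (auto simp: contraction_def)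
  then have hc: "h (c j) \<in> Idl\<^bsub>S\<^esub> (h ` T)" if "j \<in> J" for j using cI that by (auto simp: contraction_def)
  have "(\<Oplus>\<^bsub>S\<^esub>j\<in>K. h (c j) \<otimes>\<^bsub>S\<^esub> e j) \<in> Idl\<^bsub>S\<^esub> (h ` T)" if "K \<subseteq> J" for K
    using finite_subset[OF that finite_basis] that
  proof (induction K)
    case empty
    then show ?case using E.zero_closed by simp
  next
    case (insert k K)
    have "(\<Oplus>\<^bsub>S\<^esub>j\<in>insert k K. h (c j) \<otimes>\<^bsub>S\<^esub> e j) = h (c k) \<otimes>\<^bsub>S\<^esub> e k \<oplus>\<^bsub>S\<^esub> (\<Oplus>\<^bsub>S\<^esub>j\<in>K. h (c j) \<otimes>\<^bsub>S\<^esub> e j)"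
      using insert c basis_closed by (intro S.finsum_insert) (auto simp: Pi_def)
    also have "\<dots> \<in> Idl\<^bsub>S\<^esub> (h ` T)"
      using insert hc basis_closed by (intro E.a_closed E.I_r_closed) auto
    finally show ?case .
  qed
  then show "combination c \<in> Idl\<^bsub>S\<^esub> (h ` T)" unfolding combination_def by blast
qed

text \<open>Multiplication by \<open>h r\<close> acts on each coordinate as multiplication by
  \<open>r\<close>, so regularity is inherited coordinate by coordinate. Properness of the generated
  ideal comes from \<open>P\<close>, which contains the image of the sequence.\<close>

lemma regular_sequence_map:
  assumes rs: "regular_sequence R rs" and P: "maximalideal P S" and sub: "set rs \<subseteq> contraction P"
  shows "regular_sequence S (map h rs)"
  unfolding regular_sequence_def
proof (intro conjI allI impI ballI)
  interpret P: maximalideal P S by fact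
  have rsc: "set rs \<subseteq> carrier R" using rs by (simp add: regular_sequence_def)
  then show sc: "set (map h rs) \<subseteq> carrier S" by auto
  have "Idl\<^bsub>S\<^esub> (set (map h rs)) \<subseteq> P"
    using sub by (intro S.genideal_minimal P.ideal_axioms) (auto simp: contraction_def)
  then show "Idl\<^bsub>S\<^esub> (set (map h rs)) \<noteq> carrier S"
    using P.I_notcarr P.a_subset by blast
  fix i s assume i: "i < length (map h rs)" and s: "s \<in> carrier S"
    and mem: "map h rs ! i \<otimes>\<^bsub>S\<^esub> s \<in> Idl\<^bsub>S\<^esub> (set (take i (map h rs)))"
  define T where "T = set (take i rs)"
  have T: "T \<subseteq> carrier R" "set (take i (map h rs)) = h ` T"
    unfolding T_def using rsc set_take_subset[of i rs] by (auto simp: take_map)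
  obtain c where c: "c \<in> J \<rightarrow> carrier R" "s = combination c"
    using basis_span[OF s] unfolding combination_def by blast
  have ri: "rs ! i \<in> carrier R" using rsc i by auto
  have rc: "(\<lambda>j. rs ! i \<otimes> c j) \<in> J \<rightarrow> carrier R" using c ri by auto
  have "combination (\<lambda>j. rs ! i \<otimes> c j) \<in> Idl\<^bsub>S\<^esub> (h ` T)"
    using mem i unfolding c(2) T(2) by (simp add: combination_mult[OF ri c(1)])
  then have "(\<lambda>j. rs ! i \<otimes> c j) \<in> J \<rightarrow> Idl T" using genideal_image[OF T(1) rc] by blast
  then have "c \<in> J \<rightarrow> Idl T"
    using rs i c(1) unfolding regular_sequence_def T_def by (auto simp: Pi_iff)
  then show "s \<in> Idl\<^bsub>S\<^esub> (set (take i (map h rs)))" unfolding c(2) T(2) using genideal_image[OF T(1) c(1)] by blast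
qed

lemma ideal_depth_contraction:
  assumes P: "maximalideal P S"
  shows "ideal_depth R (contraction P) \<le> ideal_depth S P"
  unfolding ideal_depth_def[of R]
proof (rule Sup_least)
  fix l assume "l \<in> {enat (length rs) |rs. regular_sequence R rs \<and> set rs \<subseteq> contraction P}"
  then obtain rs where rs: "l = enat (length (map h rs))" "regular_sequence R rs" "set rs \<subseteq> contraction P"
    by auto
  have "regular_sequence S (map h rs)" using regular_sequence_map[OF rs(2) P rs(3)] .
  moreover have "set (map h rs) \<subseteq> P" using rs(3) by (auto simp: contraction_def)
  ultimately show "l \<le> ideal_depth S P" unfolding ideal_depth_def rs(1) by (intro Sup_upper) blast
qed

theorem cohen_macaulay_extension:
  assumes "cohen_macaulay R"
  shows "cohen_macaulay S"
  unfolding cohen_macaulay_def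
proof (intro conjI allI impI S.is_cring noetherian_extension)
  fix P assume P: "maximalideal P S"
  have "prime_height S P \<le> prime_height R (contraction P)" by (rule prime_height_contraction)
  also have "\<dots> = ideal_depth R (contraction P)"
    using assms maximalideal_contraction[OF P] by (simp add: cohen_macaulay_def)
  also have "\<dots> \<le> ideal_depth S P" by (rule ideal_depth_contraction[OF P])
  finally show "ideal_depth S P = prime_height S P"
    using S.ideal_depth_le_prime_height[OF noetherian_extension S.maximalideal_prime[OF P]] by simp
qed

end

subsection \<open>Kernels of monomial maps\<close>

definition push :: "('a \<Rightarrow> 'b) \<Rightarrow> ('a \<Rightarrow>\<^sub>0 'k::comm_ring_1) \<Rightarrow> ('b \<Rightarrow>\<^sub>0 'k)" where
  "push q f = (\<Sum>v\<in>Poly_Mapping.keys f. Poly_Mapping.single (q v) (Poly_Mapping.lookup f v))"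

lemma push_superset:
  assumes "finite V" "Poly_Mapping.keys f \<subseteq> V"
  shows "push q f = (\<Sum>v\<in>V. Poly_Mapping.single (q v) (Poly_Mapping.lookup f v))"
  unfolding push_def using assms by (intro sum.mono_neutral_left) (auto simp: in_keys_iff)

lemma push_zero [simp]: "push q 0 = 0"
  by (simp add: push_def)

lemma push_single [simp]: "push q (Poly_Mapping.single v c) = Poly_Mapping.single (q v) c"
  by (subst push_superset[of "{v}"]) auto

lemma push_add [simp]: "push q (f + g) = push q f + push q g"
proof -
  let ?V = "Poly_Mapping.keys f \<union> Poly_Mapping.keys g"
  have "push q (f + g) = (\<Sum>v\<in>?V. Poly_Mapping.single (q v) (Poly_Mapping.lookup (f + g) v))"
    using keys_add[of f g] by (intro push_superset) auto
  also have "\<dots> = push q f + push q g"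
    by (simp add: push_superset[of ?V f] push_superset[of ?V g] lookup_add single_add sum.distrib)
  finally show ?thesis .
qed

lemma push_uminus [simp]: "push q (- f) = - push q f"
  using push_add[of q f "- f"] by (simp add: eq_neg_iff_add_eq_0 add.commute)

lemma push_diff [simp]: "push q (f - g) = push q f - push q g"
  using push_add[of q f "- g"] by simp

lemma lookup_push: "Poly_Mapping.lookup (push q f) x = (\<Sum>v | v \<in> Poly_Mapping.keys f \<and> q v = x. Poly_Mapping.lookup f v)"
  by (auto simp: push_def lookup_sum lookup_single when_def sum.If_cases intro!: sum.cong)

lemma poly_mapping_eq_sum_single:
  fixes f :: "'a \<Rightarrow>\<^sub>0 'k::comm_monoid_add"
  shows "f = (\<Sum>v\<in>Poly_Mapping.keys f. Poly_Mapping.single v (Poly_Mapping.lookup f v))"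
  by (rule poly_mapping_eqI) (simp add: lookup_sum lookup_single when_def in_keys_iff)

lemma poly_mapping_additive_induct [case_names zero single add]:
  fixes f :: "'a \<Rightarrow>\<^sub>0 'k::comm_monoid_add"
  assumes "P 0" "\<And>v c. v \<in> Poly_Mapping.keys f \<Longrightarrow> P (Poly_Mapping.single v c)"
    and "\<And>f g. P f \<Longrightarrow> P g \<Longrightarrow> P (f + g)"
  shows "P f"
proof -
  have "P (\<Sum>v\<in>V. Poly_Mapping.single v (Poly_Mapping.lookup f v))" if "V \<subseteq> Poly_Mapping.keys f" for V
    using finite_subset[OF that finite_keys] that by induction (use assms in auto)
  then show ?thesis by (metis poly_mapping_eq_sum_single subset_refl)
qed

lemma push_mult:
  fixes q :: "'a::monoid_add \<Rightarrow> 'b::monoid_add"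
  assumes "\<And>v w. q (v + w) = q v + q w"
  shows "push q (f * g) = push q f * push q g"
proof (induction f rule: poly_mapping_additive_induct)
  case (single v c)
  show ?case
    by (induction g rule: poly_mapping_additive_induct) (simp_all add: mult_single assms distrib_left)
qed (simp_all add: distrib_right)

text \<open>The kernel is spanned by binomials. If \<open>push q f = 0\<close>, a key
  \<open>v\<close> cannot be alone in its fibre, so another key \<open>w\<close> has the same image;
  moving the coefficient of \<open>v\<close> to \<open>w\<close> subtracts such a binomial and
  removes \<open>v\<close> from the support.\<close>

lemma push_kernel_induct [consumes 1, case_names zero add_binomial]:
  assumes "push q f = 0" "P 0"
    and step: "\<And>f v w c. P f \<Longrightarrow> q v = q w \<Longrightarrow> P (f + (Poly_Mapping.single v c - Poly_Mapping.single w c))"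
  shows "P f"
  using assms(1)
proof (induction "card (Poly_Mapping.keys f)" arbitrary: f rule: less_induct)
  case less
  show ?case
  proof (cases "f = 0")
    case False
    then obtain v where v: "v \<in> Poly_Mapping.keys f"
      unfolding in_keys_iff by (metis poly_mapping_eqI lookup_zero)
    define c where "c = Poly_Mapping.lookup f v"
    have "c \<noteq> 0" using v by (simp add: c_def in_keys_iff)
    obtain w where w: "w \<in> Poly_Mapping.keys f" "q w = q v" "w \<noteq> v"
    proof (rule ccontr)
      assume "\<not> thesis"
      then have "{w \<in> Poly_Mapping.keys f. q w = q v} = {v}" using that v by auto
      then have "Poly_Mapping.lookup (push q f) (q v) = c" by (simp add: lookup_push c_def)
      then show False using less.prems \<open>c \<noteq> 0\<close> by simp
    qed
    define g where "g = f + (Poly_Mapping.single w c - Poly_Mapping.single v c)"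
    have "u \<in> Poly_Mapping.keys f - {v}" if "u \<in> Poly_Mapping.keys g" for u
      using that w v
      by (cases "u = v"; cases "u = w") (auto simp: in_keys_iff g_def c_def lookup_add lookup_minus lookup_single when_def)
    then have "Poly_Mapping.keys g \<subset> Poly_Mapping.keys f" using v by blast
    then have "card (Poly_Mapping.keys g) < card (Poly_Mapping.keys f)" by (simp add: psubset_card_mono)
    moreover have "push q g = 0" using less.prems w by (simp add: g_def)
    ultimately have "P g" using less.hyps by blast
    then have "P (g + (Poly_Mapping.single v c - Poly_Mapping.single w c))" using w by (intro step) auto
    then show ?thesis by (simp add: g_def)
  qed (use assms(2) in simp)
qed

text \<open>When translation respects the fibres of \<open>q\<close>, a translated binomial still
  has both exponents in one fibre, and such binomials span the kernel.\<close>

lemma push_kernel_mult: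
  fixes q :: "'a::comm_monoid_add \<Rightarrow> 'b"
  assumes "\<And>u v w. q v = q w \<Longrightarrow> q (u + v) = q (u + w)" and f: "push q f = 0"
  shows "push q (g * f) = 0"
  using f
proof (induction f rule: push_kernel_induct)
  case zero
  then show ?case by simp
next
  case (add_binomial f v w c)
  have "push q (g * (Poly_Mapping.single v c - Poly_Mapping.single w c)) = 0"
  proof (induction g rule: poly_mapping_additive_induct)
    case (single u d)
    then show ?case using assms(1)[OF add_binomial(2)] by (simp add: right_diff_distrib mult_single)
  qed (simp_all add: distrib_right)
  then show ?case using add_binomial by (simp add: distrib_left)
qed

lemma prod_single_power:
  fixes g :: "'i \<Rightarrow> nat ^ 'm"
  shows "(\<Prod>i\<in>I. Poly_Mapping.single (g i) (1::'k::comm_ring_1) ^ a i) = Poly_Mapping.single (\<Sum>i\<in>I. a i *s g i) 1"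
proof -
  have "Poly_Mapping.single v (1::'k) ^ n = Poly_Mapping.single (n *s v) 1" for v :: "nat ^ 'm" and n
    by (induction n) (auto simp: mult_single vec_eq_iff algebra_simps intro!: arg_cong2[where f = Poly_Mapping.single])
  then show ?thesis
    by (induction I rule: infinite_finite_induct) (auto simp: mult_single)
qed

lemma mpoly_map_single:
  fixes g :: "'n::finite \<Rightarrow> nat ^ 'm::finite" and f :: "('k::field, 'n) mpoly"
  shows "mpoly_map (\<lambda>i. Poly_Mapping.single (g i) 1) f = push (\<lambda>v. \<Sum>i\<in>UNIV. v $ i *s g i) f"
  unfolding mpoly_map_def push_def by (simp add: prod_single_power mconst_def mult_single)

lemma toric_ideal_eq: "toric_ideal A = {f. push ((*v) A) f = 0}"
proof -
  have "(\<Sum>i\<in>UNIV. v $ i *s column i A) = A *v v" for v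
    by (simp add: vec_eq_iff matrix_vector_mult_def column_def mult.commute)
  then show ?thesis by (simp add: toric_ideal_def mpoly_map_single)
qed

definition vec_join :: "'a ^ 'p \<Rightarrow> 'a ^ 'q \<Rightarrow> 'a ^ ('p + 'q)" where
  "vec_join u w = (\<chi> s. case s of Inl i \<Rightarrow> u $ i | Inr j \<Rightarrow> w $ j)"

lemma vec_join_nth [simp]: "vec_join u w $ Inl i = u $ i" "vec_join u w $ Inr j = w $ j"
  by (simp_all add: vec_join_def)

lemma vec_join_eq_iff: "x = y \<longleftrightarrow> (\<forall>i. x $ Inl i = y $ Inl i) \<and> (\<forall>j. x $ Inr j = y $ Inr j)"
  by (metis old.sum.exhaust vec_eq_iff)

lemma vec_join_cases [cases type]:
  obtains u w where "x = vec_join u w"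
  by (rule that[of "\<chi> i. x $ Inl i" "\<chi> j. x $ Inr j"]) (simp add: vec_join_eq_iff)

lemma vec_join_inject [simp]: "vec_join u w = vec_join u' w' \<longleftrightarrow> u = u' \<and> w = w'"
  by (auto simp: vec_join_eq_iff vec_eq_iff[of u] vec_eq_iff[of w])

lemma vec_join_add: "vec_join u w + vec_join u' w' = vec_join (u + u') (w + w')"
  by (simp add: vec_join_eq_iff)

lemma glue_matrix_mult: "glue_matrix k1 k2 A B *v vec_join u w = k1 *s (A *v u) + k2 *s (B *v w)"
  by (simp add: vec_eq_iff matrix_vector_mult_def glue_matrix_def UNIV_Plus_UNIV[symmetric] sum.Plus
      sum_distrib_left mult.assoc del: UNIV_Plus_UNIV)

lemma sum_axis_join:
  fixes u :: "nat ^ 'p::finite" and w :: "nat ^ 'q::finite"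
  shows "(\<Sum>i\<in>UNIV. u $ i *s axis (Inl i) 1) = vec_join u (0 :: nat ^ 'q)"
    and "(\<Sum>j\<in>UNIV. w $ j *s axis (Inr j) 1) = vec_join (0 :: nat ^ 'p) w"
  by (auto simp: vec_join_eq_iff axis_def if_distrib cong: if_cong)

lemma mpoly_map_join:
  fixes f :: "('k::field, 'p::finite) mpoly" and g :: "('k, 'q::finite) mpoly"
  shows "mpoly_map (\<lambda>i. mvar (Inl i)) f = push (\<lambda>u. vec_join u (0 :: nat ^ 'q)) f"
    and "mpoly_map (\<lambda>j. mvar (Inr j)) g = push (\<lambda>w. vec_join (0 :: nat ^ 'p) w) g"
  by (simp_all add: mvar_def mpoly_map_single sum_axis_join del: One_nat_def)

lemma prod_mvar_join:
  fixes u :: "nat ^ 'p::finite" and w :: "nat ^ 'q::finite"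
  shows "(\<Prod>i\<in>UNIV. mvar (Inl i) ^ (u $ i)) = Poly_Mapping.single (vec_join u (0 :: nat ^ 'q)) (1 :: 'k::field)"
    and "(\<Prod>j\<in>UNIV. mvar (Inr j) ^ (w $ j)) = Poly_Mapping.single (vec_join (0 :: nat ^ 'p) w) (1 :: 'k::field)"
  by (simp_all add: mvar_def prod_single_power sum_axis_join del: One_nat_def)

subsection \<open>Gluings and coincidences of degrees\<close>

lemma (in ring) set_add_genideals:
  assumes "T \<subseteq> carrier R" "U \<subseteq> carrier R" "V \<subseteq> carrier R"
  defines "K \<equiv> set_add R (set_add R (Idl T) (Idl U)) (Idl V)"
  shows ideal_set_add_genideals: "ideal K R"
    and subset_set_add_genideals: "T \<union> U \<union> V \<subseteq> K"
    and set_add_genideals_minimal: "ideal I R \<Longrightarrow> T \<union> U \<union> V \<subseteq> I \<Longrightarrow> K \<subseteq> I"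
proof -
  have i: "ideal (Idl T) R" "ideal (Idl U) R" "ideal (Idl V) R"
    using assms(1-3) by (simp_all add: genideal_ideal)
  have i2: "ideal (set_add R (Idl T) (Idl U)) R" using i by (simp add: add_ideals)
  note TU = union_genideal[OF i(1,2)] and K = union_genideal[OF i2 i(3)]
  have carr: "Idl T \<subseteq> carrier R" "Idl U \<subseteq> carrier R" "Idl V \<subseteq> carrier R"
    "set_add R (Idl T) (Idl U) \<subseteq> carrier R"
    using i i2 by (simp_all add: ideal.axioms(1) additive_subgroup.a_subset)
  show "ideal K R" unfolding K_def using i2 i by (simp add: add_ideals)
  have "Idl T \<union> Idl U \<subseteq> set_add R (Idl T) (Idl U)"
    unfolding TU[symmetric] using carr by (intro genideal_self) auto
  moreover have "set_add R (Idl T) (Idl U) \<union> Idl V \<subseteq> K"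
    unfolding K_def K[symmetric] using carr by (intro genideal_self) auto
  ultimately show "T \<union> U \<union> V \<subseteq> K"
    using genideal_self[OF assms(1)] genideal_self[OF assms(2)] genideal_self[OF assms(3)] by blast
  assume I: "ideal I R" "T \<union> U \<union> V \<subseteq> I"
  then have "Idl T \<subseteq> I" "Idl U \<subseteq> I" "Idl V \<subseteq> I" by (simp_all add: genideal_minimal)
  moreover from this have "set_add R (Idl T) (Idl U) \<subseteq> I"
    unfolding TU[symmetric] using I by (intro genideal_minimal) auto
  ultimately show "K \<subseteq> I" unfolding K_def K[symmetric] using I by (intro genideal_minimal) auto
qed

lemma ideal_ring_of_type_algebra_iff:
  fixes I :: "'a::comm_ring_1 set"
  shows "ideal I ring_of_type_algebra \<longleftrightarrow> 0 \<in> I \<and> (\<forall>x\<in>I. \<forall>y\<in>I. x + y \<in> I) \<and> (\<forall>r. \<forall>x\<in>I. r * x \<in> I)"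
proof
  assume I: "ideal I ring_of_type_algebra"
  note * = additive_subgroup.zero_closed[OF ideal.axioms(1)[OF I]]
    additive_subgroup.a_closed[OF ideal.axioms(1)[OF I]] ideal.I_l_closed[OF I]
  show "0 \<in> I \<and> (\<forall>x\<in>I. \<forall>y\<in>I. x + y \<in> I) \<and> (\<forall>r. \<forall>x\<in>I. r * x \<in> I)"
    using *(1) *(2) *(3) by (simp add: ring_of_type_algebra_def)
next
  assume "0 \<in> I \<and> (\<forall>x\<in>I. \<forall>y\<in>I. x + y \<in> I) \<and> (\<forall>r. \<forall>x\<in>I. r * x \<in> I)"
  then show "ideal I ring_of_type_algebra"
    by (intro cring.cring_idealI cring_from_type_algebra) (auto simp: ring_of_type_algebra_def)
qed

lemma ideal_push_kernel:
  fixes q :: "'a::comm_monoid_add \<Rightarrow> 'b"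
  assumes "\<And>u v w. q v = q w \<Longrightarrow> q (u + v) = q (u + w)"
  shows "ideal {f :: 'a \<Rightarrow>\<^sub>0 'k::comm_ring_1. push q f = 0} ring_of_type_algebra"
  unfolding ideal_ring_of_type_algebra_iff by (auto intro: push_kernel_mult assms)

text \<open>
  \<open>x - y\<close> is an integral multiple of \<open>d\<close>, written without subtraction.
\<close>

definition multiple_apart :: "nat ^ 'n \<Rightarrow> nat ^ 'n \<Rightarrow> nat ^ 'n \<Rightarrow> bool" where
  "multiple_apart d x y \<longleftrightarrow> (\<exists>n m. x + n *s d = y + m *s d)"

lemma multiple_apart_refl: "multiple_apart d x x"
  by (auto simp: multiple_apart_def)

lemma multiple_apart_sym: "multiple_apart d x y \<Longrightarrow> multiple_apart d y x"
  unfolding multiple_apart_def by metis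

lemma multiple_apart_trans:
  assumes "multiple_apart d x y" "multiple_apart d y z"
  shows "multiple_apart d x z"
proof -
  obtain n m n' m' where *: "x + n *s d = y + m *s d" "y + n' *s d = z + m' *s d"
    using assms unfolding multiple_apart_def by blast
  have "x + (n + n') *s d = (x + n *s d) + n' *s d" by (simp add: vector_sadd_rdistrib add.assoc)
  also have "\<dots> = (y + n' *s d) + m *s d" unfolding *(1) by (simp add: add_ac)
  also have "\<dots> = z + (m' + m) *s d" unfolding *(2) by (simp add: vector_sadd_rdistrib add.assoc)
  finally show ?thesis unfolding multiple_apart_def by blast
qed

lemma multiple_apart_add:
  assumes "multiple_apart d x y"
  shows "multiple_apart d (z + x) (z + y)"
  using assms unfolding multiple_apart_def by (metis add.assoc)

text \<open>Over the naturals the smaller of the two multiples cancels, so an integral multiple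
  becomes a natural multiple added on one of the two sides.\<close>

lemma multiple_apart_cases:
  assumes "multiple_apart d x y"
  obtains t where "x = y + t *s d" | t where "y = x + t *s d"
proof -
  obtain n m where eq: "x + n *s d = y + m *s d" using assms unfolding multiple_apart_def by blast
  show ?thesis
  proof (cases "n \<le> m")
    case True
    then obtain t where "m = t + n" by (metis le_add_diff_inverse2)
    then have "x + n *s d = (y + t *s d) + n *s d" using eq by (simp add: vector_sadd_rdistrib add.assoc)
    then show ?thesis using that(1) by simp
  next
    case False
    then obtain t where "n = t + m" by (metis le_add_diff_inverse2 nat_le_linear)
    then have "(x + t *s d) + m *s d = y + m *s d" using eq by (simp add: vector_sadd_rdistrib add.assoc)
    then show ?thesis using that(2) by (metis add_right_cancel)
  qed
qed

text \<open>Being a gluing, freed from the field. The three conjuncts stand for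
  \<open>\<rho> \<noteq> 0\<close>, for membership of \<open>\<rho>\<close> in I_C, and for
  generation of I_C by I_A, I_B and \<open>\<rho>\<close>. The last one records the
  \<open>A\<close>-side; \<open>glues_swap\<close> recovers the \<open>B\<close>-side.\<close>

definition glues :: "nat \<Rightarrow> nat \<Rightarrow> nat ^ 'p ^ 2 \<Rightarrow> nat ^ 'q ^ 2 \<Rightarrow> nat ^ 'p \<Rightarrow> nat ^ 'q \<Rightarrow> bool" where
  "glues k1 k2 A B \<alpha> \<beta> \<longleftrightarrow> (\<alpha> \<noteq> 0 \<or> \<beta> \<noteq> 0) \<and> k1 *s (A *v \<alpha>) = k2 *s (B *v \<beta>) \<and>
     (\<forall>u w u' w'. k1 *s (A *v u) + k2 *s (B *v w) = k1 *s (A *v u') + k2 *s (B *v w')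
        \<longrightarrow> multiple_apart (A *v \<alpha>) (A *v u) (A *v u'))"

lemma matrix_vector_mult_smult: "A *v (c *s x) = c *s (A *v x)" for A :: "nat ^ 'n ^ 'm"
  by (simp add: vec_eq_iff matrix_vector_mult_def sum_distrib_left mult_ac)

lemma vector_mult_left_cancel_nat: "0 < k \<Longrightarrow> k *s (x :: nat ^ 'n) = k *s y \<longleftrightarrow> x = y"
  by (simp add: vec_eq_iff)

lemma glue_equation_cancel:
  fixes x x' y y' a b :: "nat ^ 'n"
  assumes eq: "k1 *s x + k2 *s y = k1 *s x' + k2 *s y'" and d: "k1 *s a = k2 *s b"
    and x: "x = x' + t *s a" and k2: "0 < k2"
  shows "y' = y + t *s b"
proof -
  have "k1 *s x = k1 *s x' + t *s (k1 *s a)"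
    unfolding x by (simp add: vector_add_ldistrib vector_smult_assoc mult.commute)
  then have "k1 *s x = k1 *s x' + k2 *s (t *s b)"
    unfolding d by (simp add: vector_smult_assoc mult.commute)
  then have "k1 *s x' + k2 *s y' = k1 *s x' + k2 *s (y + t *s b)"
    using eq by (simp add: vector_add_ldistrib add_ac)
  then show ?thesis using vector_mult_left_cancel_nat[OF k2] by (metis add_left_cancel)
qed

text \<open>A shift by \<open>t *s (A *v \<alpha>)\<close> on one side must be balanced by the shift
  \<open>t *s (B *v \<beta>)\<close> on the other, because
  \<open>k1 *s (A *v \<alpha>) = k2 *s (B *v \<beta>)\<close>.\<close>

lemma glues_swap:
  assumes "glues k1 k2 A B \<alpha> \<beta>" "0 < k2"
  shows "glues k2 k1 B A \<beta> \<alpha>"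
proof -
  have d: "k1 *s (A *v \<alpha>) = k2 *s (B *v \<beta>)" and nz: "\<beta> \<noteq> 0 \<or> \<alpha> \<noteq> 0" using assms by (auto simp: glues_def)
  have "multiple_apart (B *v \<beta>) (B *v w) (B *v w')"
    if eq: "k2 *s (B *v w) + k1 *s (A *v u) = k2 *s (B *v w') + k1 *s (A *v u')" for u w u' w'
  proof -
    have eq': "k1 *s (A *v u) + k2 *s (B *v w) = k1 *s (A *v u') + k2 *s (B *v w')"
      using eq by (simp add: add.commute)
    then have "multiple_apart (A *v \<alpha>) (A *v u) (A *v u')" using assms(1) by (auto simp: glues_def)
    then have "\<exists>t. B *v w' = B *v w + t *s (B *v \<beta>) \<or> B *v w = B *v w' + t *s (B *v \<beta>)"
      using glue_equation_cancel[OF eq' d _ assms(2)] glue_equation_cancel[OF eq'[symmetric] d _ assms(2)]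
      by (elim multiple_apart_cases) blast+
    moreover have "z + 0 *s d = z" for z d :: "nat ^ 2" by simp
    ultimately show ?thesis unfolding multiple_apart_def by metis
  qed
  then show ?thesis unfolding glues_def using d nz by auto
qed

lemma single_one_eq_iff:
  "Poly_Mapping.single v (1::'k::zero_neq_one) = Poly_Mapping.single w 1 \<longleftrightarrow> v = w"
  by (metis keys_single singleton_inject zero_neq_one)

lemma push_toric_join:
  assumes "push ((*v) A) f = 0" and "\<And>v w. A *v v = A *v w \<Longrightarrow> q (i v) = q (i w)"
  shows "push q (push i f) = 0"
  using assms(1)
proof (induction f rule: push_kernel_induct)
  case (add_binomial f v w c)
  then show ?case using assms(2)[OF add_binomial(2)] by simp
qed simp

text \<open>The map \<open>q\<close> records the degree and the class of the \<open>A\<close>-part.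
  Relations of \<open>A\<close> preserve the degree of the \<open>A\<close>-part, those of
  \<open>B\<close> leave the \<open>A\<close>-part alone, and \<open>\<rho>\<close> changes it by
  \<open>A *v \<alpha>\<close>; so all generators lie in the kernel of \<open>push q\<close>. This
  kernel is an ideal, hence no binomial of I_C leaves a class.\<close>

lemma is_gluingD:
  fixes A :: "nat ^ 'p::finite ^ 2" and B :: "nat ^ 'q::finite ^ 2"
  assumes "is_gluing TYPE('k::field) k1 k2 A B"
  shows "\<exists>\<alpha> \<beta>. glues k1 k2 A B \<alpha> \<beta>"
proof -
  let ?R = "ring_of_type_algebra :: ('k, 'p + 'q) mpoly ring"
  interpret R: cring ?R by (rule cring_from_type_algebra)
  let ?x = "\<lambda>u. Poly_Mapping.single (vec_join u (0 :: nat ^ 'q)) (1 :: 'k)"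
  let ?y = "\<lambda>w. Poly_Mapping.single (vec_join (0 :: nat ^ 'p) w) (1 :: 'k)"
  let ?C = "glue_matrix k1 k2 A B"
  obtain \<alpha> \<beta> where nz: "?x \<alpha> - ?y \<beta> \<noteq> 0" and IC: "(toric_ideal ?C :: ('k, 'p + 'q) mpoly set) =
      set_add ?R
        (set_add ?R
          (genideal ?R (push (\<lambda>u. vec_join u 0) ` toric_ideal A))
          (genideal ?R (push (\<lambda>w. vec_join 0 w) ` toric_ideal B)))
        (genideal ?R {?x \<alpha> - ?y \<beta>})"
    using assms unfolding is_gluing_def Let_def mpoly_map_join prod_mvar_join mpoly_map_join by blast
  have carr: "T \<subseteq> carrier ?R" for T by (simp add: ring_of_type_algebra_def)
  note gens = R.set_add_genideals[OF carr carr carr,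
      where T = "push (\<lambda>u. vec_join u 0) ` toric_ideal A"
        and U = "push (\<lambda>w. vec_join 0 w) ` toric_ideal B" and V = "{?x \<alpha> - ?y \<beta>}",
      folded IC]
  have "?x \<alpha> - ?y \<beta> \<in> toric_ideal ?C" using gens(2) by blast
  then have "Poly_Mapping.single (?C *v vec_join \<alpha> 0) (1::'k) = Poly_Mapping.single (?C *v vec_join 0 \<beta>) 1"
    by (simp add: toric_ideal_eq)
  then have d: "k1 *s (A *v \<alpha>) = k2 *s (B *v \<beta>)"
    by (simp add: glue_matrix_mult single_one_eq_iff)
  define fst_part where "fst_part e = (\<chi> i. e $ Inl i)" for e :: "nat ^ ('p + 'q)"
  have fst_part: "fst_part (vec_join u w) = u" "fst_part (e + e') = fst_part e + fst_part e'" for u w e e'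
    by (simp_all add: fst_part_def vec_eq_iff)
  \<comment> \<open>Classes represented as sets stand for the quotient of the plane by
    \<open>A *v \<alpha>\<close>, so that equality of values of \<open>q\<close> can express the
    relation.\<close>
  define cls where "cls x = {y. multiple_apart (A *v \<alpha>) x y}" for x
  have cls: "cls x = cls y \<longleftrightarrow> multiple_apart (A *v \<alpha>) x y" for x y
    unfolding cls_def using multiple_apart_refl multiple_apart_sym multiple_apart_trans by blast
  define q where "q e = (?C *v e, cls (A *v fst_part e))" for e
  have q_add: "q (u + v) = q (u + w)" if "q v = q w" for u v w
    using that multiple_apart_add by (auto simp: q_def cls matrix_vector_right_distrib fst_part)
  have "toric_ideal ?C \<subseteq> {f :: ('k, 'p + 'q) mpoly. push q f = 0}"
  proof (rule gens(3))
    show "ideal {f :: ('k, 'p + 'q) mpoly. push q f = 0} ?R" by (rule ideal_push_kernel) (rule q_add)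
    have "push q (push (\<lambda>u. vec_join u 0) f) = 0" if "f \<in> toric_ideal A" for f :: "('k, 'p) mpoly"
      using that unfolding toric_ideal_eq
      by (intro push_toric_join[of A]) (auto simp: q_def fst_part glue_matrix_mult)
    moreover have "push q (push (\<lambda>w. vec_join 0 w) f) = 0" if "f \<in> toric_ideal B" for f :: "('k, 'q) mpoly"
      using that unfolding toric_ideal_eq
      by (intro push_toric_join[of B]) (auto simp: q_def fst_part glue_matrix_mult)
    moreover have "q (vec_join \<alpha> 0) = q (vec_join 0 \<beta>)"
    proof -
      have "A *v \<alpha> + 0 *s (A *v \<alpha>) = 0 + 1 *s (A *v \<alpha>)" by (simp add: vec_eq_iff)
      then have "multiple_apart (A *v \<alpha>) (A *v \<alpha>) 0" unfolding multiple_apart_def by blast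
      then show ?thesis by (simp add: q_def fst_part glue_matrix_mult cls d)
    qed
    ultimately show "push (\<lambda>u. vec_join u 0) ` toric_ideal A \<union> push (\<lambda>w. vec_join 0 w) ` toric_ideal B \<union>
        {?x \<alpha> - ?y \<beta>} \<subseteq> {f. push q f = 0}" by auto
  qed
  then have ker: "push q f = 0" if "push ((*v) ?C) f = 0" for f :: "('k, 'p + 'q) mpoly"
    using that by (auto simp: toric_ideal_eq)
  have "multiple_apart (A *v \<alpha>) (A *v u) (A *v u')"
    if "k1 *s (A *v u) + k2 *s (B *v w) = k1 *s (A *v u') + k2 *s (B *v w')" for u w u' w'
  proof -
    have "push q (Poly_Mapping.single (vec_join u w) (1::'k) - Poly_Mapping.single (vec_join u' w') 1) = 0"
      using that by (intro ker) (simp add: glue_matrix_mult)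
    then have "q (vec_join u w) = q (vec_join u' w')"
      by (simp add: single_one_eq_iff)
    then show ?thesis by (simp add: q_def fst_part cls)
  qed
  moreover have "\<alpha> \<noteq> 0 \<or> \<beta> \<noteq> 0" using nz by auto
  ultimately show ?thesis unfolding glues_def using d by blast
qed

text \<open>A coincidence with \<open>A u = A u' + t A \<alpha>\<close> is resolved in three moves:
  from \<open>x^u y^w\<close> to \<open>x^(u' + t \<alpha>) y^w\<close> by I_A, on to
  \<open>x^u' y^(w + t \<beta>)\<close> by multiples of \<open>\<rho>\<close>, and on to
  \<open>x^u' y^w'\<close> by I_B.\<close>

lemma is_gluingI:
  fixes A :: "nat ^ 'p::finite ^ 2" and B :: "nat ^ 'q::finite ^ 2"
  assumes g: "glues k1 k2 A B \<alpha> \<beta>" and k2: "0 < k2"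
  shows "is_gluing TYPE('k::field) k1 k2 A B"
proof -
  let ?R = "ring_of_type_algebra :: ('k, 'p + 'q) mpoly ring"
  interpret R: cring ?R by (rule cring_from_type_algebra)
  let ?C = "glue_matrix k1 k2 A B"
  define mon where "mon c u w = Poly_Mapping.single (vec_join u w) c" for c :: 'k and u :: "nat ^ 'p" and w :: "nat ^ 'q"
  define \<rho> where "\<rho> = mon 1 \<alpha> 0 - mon 1 0 \<beta>"
  define I where "I = set_add ?R
        (set_add ?R
          (genideal ?R (push (\<lambda>u. vec_join u 0) ` toric_ideal A))
          (genideal ?R (push (\<lambda>w. vec_join 0 w) ` toric_ideal B)))
        (genideal ?R {\<rho>})"
  have d: "k1 *s (A *v \<alpha>) = k2 *s (B *v \<beta>)" and nz: "\<alpha> \<noteq> 0 \<or> \<beta> \<noteq> 0" using g by (auto simp: glues_def)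
  have carr: "T \<subseteq> carrier ?R" for T by (simp add: ring_of_type_algebra_def)
  note gens = R.set_add_genideals[OF carr carr carr,
      where T = "push (\<lambda>u. vec_join u 0) ` toric_ideal A"
        and U = "push (\<lambda>w. vec_join 0 w) ` toric_ideal B" and V = "{\<rho>}",
      folded I_def]
  have Iadd: "f + g \<in> I" if "f \<in> I" "g \<in> I" for f g
    using gens(1) that unfolding ideal_ring_of_type_algebra_iff by blast
  have Imult: "r * f \<in> I" if "f \<in> I" for r f
    using gens(1) that unfolding ideal_ring_of_type_algebra_iff by blast
  have I0: "0 \<in> I" using gens(1) unfolding ideal_ring_of_type_algebra_iff by blast
  have mon_mult: "mon c u w * mon c' u' w' = mon (c * c') (u + u') (w + w')" for c c' u u' w w'
    by (simp add: mon_def mult_single vec_join_add)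
  have left: "mon c u w - mon c u' w \<in> I" if "A *v u = A *v u'" for c u u' w
  proof -
    have "Poly_Mapping.single u (1::'k) - Poly_Mapping.single u' 1 \<in> toric_ideal A"
      using that by (simp add: toric_ideal_eq)
    then have "push (\<lambda>u. vec_join u 0) (Poly_Mapping.single u (1::'k) - Poly_Mapping.single u' 1) \<in> I"
      using gens(2) by blast
    then have "mon c 0 w * (mon 1 u 0 - mon 1 u' 0) \<in> I" by (intro Imult) (simp add: mon_def)
    then show ?thesis by (simp add: right_diff_distrib mon_mult)
  qed
  have right: "mon c u w - mon c u w' \<in> I" if "B *v w = B *v w'" for c u w w'
  proof -
    have "Poly_Mapping.single w (1::'k) - Poly_Mapping.single w' 1 \<in> toric_ideal B"
      using that by (simp add: toric_ideal_eq)
    then have "push (\<lambda>w. vec_join 0 w) (Poly_Mapping.single w (1::'k) - Poly_Mapping.single w' 1) \<in> I"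
      using gens(2) by blast
    then have "mon c u 0 * (mon 1 0 w - mon 1 0 w') \<in> I" by (intro Imult) (simp add: mon_def)
    then show ?thesis by (simp add: right_diff_distrib mon_mult)
  qed
  \<comment> \<open>A multiple of \<open>\<rho>\<close> exchanges one factor
    \<open>x^\<alpha>\<close> for \<open>y^\<beta>\<close>; the induction is general in
    \<open>w\<close>, which collects the new factors.\<close>
  have middle: "mon c (u + t *s \<alpha>) w - mon c u (w + t *s \<beta>) \<in> I" for c u w t
  proof (induction t arbitrary: w)
    case 0
    then show ?case using I0 by simp
  next
    case (Suc t)
    have "\<rho> \<in> I" using gens(2) by blast
    then have "mon c (u + t *s \<alpha>) w * \<rho> \<in> I" by (rule Imult)
    then have "mon c (u + t *s \<alpha> + \<alpha>) w - mon c (u + t *s \<alpha>) (w + \<beta>) \<in> I"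
      by (simp add: \<rho>_def right_diff_distrib mon_mult)
    then have "mon c (u + t *s \<alpha> + \<alpha>) w - mon c u (w + \<beta> + t *s \<beta>) \<in> I"
      using Iadd[OF _ Suc[of "w + \<beta>"]] by fastforce
    moreover have "u + t *s \<alpha> + \<alpha> = u + Suc t *s \<alpha>" "w + \<beta> + t *s \<beta> = w + Suc t *s \<beta>"
      by (simp_all add: vec_eq_iff)
    ultimately show ?case by simp
  qed
  have step: "mon c u w - mon c u' w' \<in> I"
    if "A *v u = A *v u' + t *s (A *v \<alpha>)" "B *v w' = B *v w + t *s (B *v \<beta>)" for c u w u' w' t
  proof -
    have "mon c u w - mon c (u' + t *s \<alpha>) w \<in> I"
      using that(1) by (intro left) (simp add: matrix_vector_right_distrib matrix_vector_mult_smult)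
    moreover have "mon c u' (w + t *s \<beta>) - mon c u' w' \<in> I"
      using that(2) by (intro right) (simp add: matrix_vector_right_distrib matrix_vector_mult_smult)
    ultimately have "(mon c u w - mon c (u' + t *s \<alpha>) w) + (mon c (u' + t *s \<alpha>) w - mon c u' (w + t *s \<beta>)) +
        (mon c u' (w + t *s \<beta>) - mon c u' w') \<in> I"
      using middle by (intro Iadd)
    then show ?thesis by simp
  qed
  have "f \<in> I" if "push ((*v) ?C) f = 0" for f
    using that
  proof (induction f rule: push_kernel_induct)
    case (add_binomial f e e' c)
    obtain u w u' w' where e: "e = vec_join u w" "e' = vec_join u' w'" by (metis vec_join_cases)
    have eq: "k1 *s (A *v u) + k2 *s (B *v w) = k1 *s (A *v u') + k2 *s (B *v w')"
      using add_binomial(2) by (simp add: e glue_matrix_mult)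
    then have "multiple_apart (A *v \<alpha>) (A *v u) (A *v u')" using g by (auto simp: glues_def)
    then have "mon c u w - mon c u' w' \<in> I"
    proof (cases rule: multiple_apart_cases)
      case (1 t)
      then show ?thesis using glue_equation_cancel[OF eq d 1 k2] by (rule step)
    next
      case (2 t)
      \<comment> \<open>The shift now sits on the primed side, so \<open>step\<close> yields the
        reversed binomial, which is then negated.\<close>
      have "mon c u' w' - mon c u w \<in> I"
        using 2 glue_equation_cancel[OF eq[symmetric] d 2 k2] by (rule step)
      then have "(- 1) * (mon c u' w' - mon c u w) \<in> I" by (rule Imult)
      then show ?thesis by simp
    qed
    then show ?case using add_binomial(1) unfolding e by (auto intro: Iadd simp: mon_def)
  qed (rule I0)
  moreover have "I \<subseteq> {f. push ((*v) ?C) f = 0}"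
  proof (rule gens(3))
    show "ideal {f :: ('k, 'p + 'q) mpoly. push ((*v) ?C) f = 0} ring_of_type_algebra"
      by (rule ideal_push_kernel) (simp add: matrix_vector_right_distrib)
    have "push ((*v) ?C) (push (\<lambda>u. vec_join u 0) f) = 0" if "f \<in> toric_ideal A" for f :: "('k, 'p) mpoly"
      using that unfolding toric_ideal_eq by (intro push_toric_join[of A]) (auto simp: glue_matrix_mult)
    moreover have "push ((*v) ?C) (push (\<lambda>w. vec_join 0 w) f) = 0" if "f \<in> toric_ideal B" for f :: "('k, 'q) mpoly"
      using that unfolding toric_ideal_eq by (intro push_toric_join[of B]) (auto simp: glue_matrix_mult)
    moreover have "push ((*v) ?C) \<rho> = 0" using d by (simp add: \<rho>_def mon_def glue_matrix_mult)
    ultimately show "push (\<lambda>u. vec_join u 0) ` toric_ideal A \<union> push (\<lambda>w. vec_join 0 w) ` toric_ideal B \<union> {\<rho>}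
        \<subseteq> {f. push ((*v) ?C) f = 0}" by auto
  qed
  ultimately have "toric_ideal ?C = I" unfolding toric_ideal_eq by blast
  moreover have "\<rho> \<noteq> 0"
  proof
    assume "\<rho> = 0"
    then have "Poly_Mapping.lookup (mon 1 \<alpha> 0) (vec_join \<alpha> 0) = Poly_Mapping.lookup (mon 1 0 \<beta>) (vec_join \<alpha> 0)"
      by (simp add: \<rho>_def)
    then show False using nz by (auto simp: mon_def lookup_single when_def split: if_splits)
  qed
  ultimately show ?thesis
    unfolding is_gluing_def Let_def mpoly_map_join prod_mvar_join using I_def \<rho>_def mon_def by auto
qed

subsection \<open>Gluings in the plane\<close>

definition cross2 :: "nat ^ 2 \<Rightarrow> nat ^ 2 \<Rightarrow> int" where
  "cross2 x y = int (x $ 1) * int (y $ 2) - int (x $ 2) * int (y $ 1)"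

lemma cross2_self [simp]: "cross2 x x = 0"
  by (simp add: cross2_def)

lemma cross2_commute: "cross2 y x = - cross2 x y"
  by (simp add: cross2_def algebra_simps)

lemma cross2_add_left: "cross2 (x + y) z = cross2 x z + cross2 y z"
  by (simp add: cross2_def algebra_simps)

lemma cross2_smult_left: "cross2 (c *s x) z = int c * cross2 x z"
  by (simp add: cross2_def algebra_simps)

lemma matrix_vector_mult_axis: "A *v axis i c = c *s column i A" for A :: "nat ^ 'n ^ 'm"
  by (auto simp: vec_eq_iff matrix_vector_mult_def axis_def column_def if_distrib mult.commute cong: if_cong)

text \<open>Without negative entries nothing can cancel: in a vanishing coordinate each summand is
  zero.\<close>

lemma matrix_vector_mult_eq_0_nat:
  fixes A :: "nat ^ 'n ^ 'm"
  assumes "\<And>i. column i A \<noteq> 0" "A *v x = 0"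
  shows "x = 0"
proof -
  have "x $ i = 0" for i
  proof -
    obtain r where r: "A $ r $ i \<noteq> 0" using assms(1)[of i] by (auto simp: vec_eq_iff column_def)
    have "(A *v x) $ r = 0" using assms(2) by simp
    then show ?thesis using r by (auto simp: matrix_vector_mult_def dest: spec[of _ i])
  qed
  then show ?thesis by (simp add: vec_eq_iff)
qed

lemma glues_nonzero:
  assumes "glues k1 k2 A B \<alpha> \<beta>" "0 < k1" "0 < k2"
    and "\<And>i. column i A \<noteq> 0" "\<And>j. column j B \<noteq> 0"
  shows "A *v \<alpha> \<noteq> 0" "B *v \<beta> \<noteq> 0"
proof -
  have eq: "k1 *s (A *v \<alpha>) = k2 *s (B *v \<beta>)" and nz: "\<alpha> \<noteq> 0 \<or> \<beta> \<noteq> 0" using assms(1) by (auto simp: glues_def)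
  have "A *v \<alpha> = 0 \<longleftrightarrow> B *v \<beta> = 0"
  proof
    assume "A *v \<alpha> = 0"
    then have "k2 *s (B *v \<beta>) = k2 *s 0" using eq by simp
    then show "B *v \<beta> = 0" by (simp only: vector_mult_left_cancel_nat[OF assms(3)])
  next
    assume "B *v \<beta> = 0"
    then have "k1 *s (A *v \<alpha>) = k1 *s 0" using eq by simp
    then show "A *v \<alpha> = 0" by (simp only: vector_mult_left_cancel_nat[OF assms(2)])
  qed
  then show "A *v \<alpha> \<noteq> 0" "B *v \<beta> \<noteq> 0"
    using nz matrix_vector_mult_eq_0_nat[OF assms(4)] matrix_vector_mult_eq_0_nat[OF assms(5)] by metis+
qed

text \<open>
  By Cramer's rule, two linearly independent columns of \<open>B\<close> put a positive multiple of each column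
  of \<open>k1 A\<close> into the group generated by the columns of \<open>k2 B\<close>.
\<close>

lemma glues_imp_parallel:
  fixes A :: "nat ^ 'p::finite ^ 2" and B :: "nat ^ 'q::finite ^ 2"
  assumes g: "glues k1 k2 A B \<alpha> \<beta>" and k2: "0 < k2" and indep: "cross2 (column j B) (column l B) \<noteq> 0"
  shows "cross2 (column i A) (A *v \<alpha>) = 0"
proof -
  have *: "cross2 (column i A) (A *v \<alpha>) = 0" if pos: "cross2 (column j B) (column l B) > 0" for j l
  proof -
    define \<Delta> where "\<Delta> = cross2 (column j B) (column l B)"
    define p where "p = cross2 (column i A) (column l B)"
    define r where "r = cross2 (column j B) (column i A)"
    \<comment> \<open>Cramer's identity \<open>\<Delta> a_i = p b_j + r b_l\<close> has integer
      coefficients. The negative parts of \<open>p\<close> and \<open>r\<close> go into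
      \<open>w\<close> and the positive parts into \<open>w'\<close>, so both sides have natural
      exponents; the factors \<open>k1\<close> and \<open>k2\<close> make it a coincidence in
      \<open>C\<close>.\<close>
    define u where "u = axis i (k2 * nat \<Delta>)"
    define w where "w = axis j (k1 * nat (- p)) + axis l (k1 * nat (- r))"
    define w' where "w' = axis j (k1 * nat p) + axis l (k1 * nat r)"
    have "k1 *s (A *v u) + k2 *s (B *v w) = k1 *s (A *v 0) + k2 *s (B *v w')"
    proof -
      have cramer: "\<Delta> * int (column i A $ s) = p * int (column j B $ s) + r * int (column l B $ s)" for s
        using exhaust_2[of s] unfolding \<Delta>_def p_def r_def cross2_def by (auto simp: algebra_simps)
      have "int ((k1 *s (A *v u) + k2 *s (B *v w)) $ s) = int ((k1 *s (A *v 0) + k2 *s (B *v w')) $ s)" for s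
      proof -
        have nats: "int (nat \<Delta>) = \<Delta>" "int (nat p) = p + int (nat (- p))" "int (nat r) = r + int (nat (- r))"
          using pos by (auto simp: \<Delta>_def)
        have "int ((k1 *s (A *v u) + k2 *s (B *v w)) $ s) = int k1 * int k2 * (\<Delta> * int (column i A $ s))
           + int k1 * int k2 * (int (nat (- p)) * int (column j B $ s) + int (nat (- r)) * int (column l B $ s))"
          using pos by (simp add: u_def w_def matrix_vector_right_distrib matrix_vector_mult_axis \<Delta>_def algebra_simps)
        also have "\<dots> = int k1 * int k2 * (int (nat p) * int (column j B $ s) + int (nat r) * int (column l B $ s))"
          unfolding cramer nats(2,3) by (simp add: algebra_simps)
        also have "\<dots> = int ((k1 *s (A *v 0) + k2 *s (B *v w')) $ s)"
          by (simp add: w'_def matrix_vector_right_distrib matrix_vector_mult_axis algebra_simps)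
        finally show ?thesis .
      qed
      then show ?thesis unfolding of_nat_eq_iff vec_eq_iff by blast
    qed
    then have "multiple_apart (A *v \<alpha>) (A *v u) (A *v 0)" using g unfolding glues_def by blast
    then obtain n m where "A *v u + n *s (A *v \<alpha>) = A *v 0 + m *s (A *v \<alpha>)"
      unfolding multiple_apart_def by blast
    \<comment> \<open>Pairing with \<open>A *v \<alpha>\<close> annihilates its multiples and leaves
      a positive multiple of the wanted determinant.\<close>
    then have "cross2 (A *v u + n *s (A *v \<alpha>)) (A *v \<alpha>) = cross2 (m *s (A *v \<alpha>)) (A *v \<alpha>)" by simp
    then have "int (k2 * nat \<Delta>) * cross2 (column i A) (A *v \<alpha>) = 0"
      by (simp add: u_def matrix_vector_mult_axis cross2_add_left cross2_smult_left del: of_nat_mult)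
    then show ?thesis using k2 pos by (simp add: \<Delta>_def)
  qed
  show ?thesis
    using *[of j l] *[of l j] indep cross2_commute[of "column j B" "column l B"] by linarith
qed

text \<open>\<open>b\<close> is the primitive vector in the direction of \<open>v\<close>. Bezout
  coefficients of its entries give a linear form with value 1 on \<open>b\<close>; on a vector
  parallel to \<open>b\<close> this form returns the factor, which is therefore an integer, and it
  is nonnegative because the entries are.\<close>

lemma parallel_columns:
  fixes B :: "nat ^ 'q::finite ^ 2"
  assumes par: "\<And>j. cross2 (column j B) v = 0" and v: "v \<noteq> 0"
  shows "\<exists>b u. \<forall>j. column j B = u j *s b"
proof -
  define g where "g = gcd (v $ 1) (v $ 2)"
  have g: "g > 0" using v by (auto simp: g_def vec_eq_iff forall_2)
  obtain b1 b2 where b: "v $ 1 = g * b1" "v $ 2 = g * b2"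
    by (metis g_def gcd_dvd1 gcd_dvd2 dvd_def)
  have "g * gcd b1 b2 = g" using b by (metis g_def gcd_mult_distrib_nat)
  then have "gcd b1 b2 = 1" using g by simp
  then have "gcd (int b1) (int b2) = 1" by (simp add: gcd_int_int_eq)
  then obtain z1 z2 where z: "z1 * int b1 + z2 * int b2 = 1" using bezout_int[of "int b1" "int b2"] by auto
  define b where "b = ((\<chi> r. if r = 1 then b1 else b2) :: nat ^ 2)"
  have bc: "b $ 1 = b1" "b $ 2 = b2" by (simp_all add: b_def)
  have "\<exists>u. column j B = u *s b" for j
  proof -
    define x1 x2 where "x1 = int (column j B $ 1)" and "x2 = int (column j B $ 2)"
    have "int g * (x1 * int b2 - x2 * int b1) = 0"
      using par[of j] b by (simp add: cross2_def x1_def x2_def algebra_simps)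
    then have eq: "x1 * int b2 = x2 * int b1" using g by simp
    define u where "u = z1 * x1 + z2 * x2"
    have "u * int b1 = z1 * int b1 * x1 + z2 * (x2 * int b1)" by (simp add: u_def algebra_simps)
    also have "\<dots> = (z1 * int b1 + z2 * int b2) * x1" unfolding eq[symmetric] by (simp add: algebra_simps)
    finally have u1: "u * int b1 = x1" using z by simp
    have "u * int b2 = z1 * (x1 * int b2) + z2 * int b2 * x2" by (simp add: u_def algebra_simps)
    also have "\<dots> = (z1 * int b1 + z2 * int b2) * x2" unfolding eq by (simp add: algebra_simps)
    finally have u2: "u * int b2 = x2" using z by simp
    have "u \<ge> 0"
    proof (rule ccontr)
      assume "\<not> u \<ge> 0"
      have "b1 > 0 \<or> b2 > 0" using z by (cases "b1 = 0"; cases "b2 = 0") auto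
      then have "u * int b1 < 0 \<or> u * int b2 < 0" using \<open>\<not> u \<ge> 0\<close> by (auto simp: mult_less_0_iff)
      then show False using u1 u2 by (simp add: x1_def x2_def)
    qed
    then have "int (column j B $ 1) = int (nat u * b1)" "int (column j B $ 2) = int (nat u * b2)"
      using u1 u2 by (simp_all add: x1_def x2_def)
    then have "column j B = nat u *s b" unfolding of_nat_eq_iff by (simp add: vec_eq_iff forall_2 bc)
    then show ?thesis by blast
  qed
  then show ?thesis by metis
qed

lemma matrix_vector_mult_multiples:
  fixes B :: "nat ^ 'q::finite ^ 'n"
  assumes "\<And>j. column j B = u j *s b"
  shows "B *v x = (\<Sum>j\<in>UNIV. u j * x $ j) *s b"
proof -
  have "B $ r $ j = u j * b $ r" for r j using assms[of j] by (metis column_def vec_lambda_beta vector_smult_component)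
  then show ?thesis by (simp add: vec_eq_iff matrix_vector_mult_def sum_distrib_left mult_ac)
qed

text \<open>This merges the two cases of the condition. When \<open>B\<close> has a single column,
  the definition requires \<open>b\<close> to be this column, whereas the vector on the right may be
  a proper divisor of it; scaling \<open>x\<close> by the factor repairs this.\<close>

lemma gluing_condition_iff:
  fixes A :: "nat ^ 'p::finite ^ 2" and B :: "nat ^ 'q::finite ^ 2"
  assumes "\<And>j. column j B \<noteq> 0"
  shows "gluing_condition A B \<longleftrightarrow> (\<exists>b u d x. (\<forall>j. column j B = u j *s b) \<and> d \<ge> 1 \<and> A *v x = d *s b)"
    (is "_ \<longleftrightarrow> ?R")
proof
  assume "gluing_condition A B"
  then obtain b d x where d: "d \<ge> 1" "A *v x = d *s b"
    and "CARD('q) = 1 \<and> columns B = {b} \<or> CARD('q) \<ge> 2 \<and> (\<exists>u :: 'q \<Rightarrow> nat. \<forall>j. column j B = u j *s b)"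
    unfolding gluing_condition_def by blast
  then have "\<exists>u. \<forall>j. column j B = u j *s b"
  proof (elim disjE conjE)
    assume "columns B = {b}"
    then have "column j B = 1 *s b" for j unfolding columns_def by (auto simp: vec_eq_iff)
    then show ?thesis by (intro exI[of _ "\<lambda>_. 1"]) simp
  qed
  then show ?R using d by blast
next
  assume ?R
  then obtain b u d x where b: "\<And>j. column j B = u j *s b" and d: "d \<ge> 1" "A *v x = d *s b" by blast
  show "gluing_condition A B"
  proof (cases "CARD('q) = 1")
    case True
    then obtain j where j: "UNIV = {j :: 'q}" by (auto simp: card_1_singleton_iff)
    have "columns B = {column j B}" unfolding columns_def using j by auto
    moreover have "A *v (u j *s x) = d *s column j B"
      using d b[of j] by (simp add: matrix_vector_mult_smult vector_smult_assoc mult.commute)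
    ultimately show ?thesis unfolding gluing_condition_def using True d(1) by blast
  next
    case False
    have "CARD('q) \<noteq> 0" by simp
    then have "CARD('q) \<ge> 2" using False by linarith
    then show ?thesis unfolding gluing_condition_def using b d by blast
  qed
qed

text \<open>The common element \<open>k1 *s (A *v \<alpha>) = k2 *s (B *v \<beta>)\<close> supplies
  the solution: it is a multiple \<open>d *s b\<close>, and it is nonzero, whence
  \<open>d \<ge> 1\<close>.\<close>

lemma glues_imp_gluing_condition:
  fixes A :: "nat ^ 'p::finite ^ 2" and B :: "nat ^ 'q::finite ^ 2"
  assumes g: "glues k1 k2 A B \<alpha> \<beta>" and k: "0 < k1" "0 < k2"
    and nz: "\<And>i. column i A \<noteq> 0" "\<And>j. column j B \<noteq> 0"
    and par: "\<And>j. cross2 (column j B) v = 0" "v \<noteq> 0"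
  shows "gluing_condition A B"
proof -
  obtain b u where b: "\<And>j. column j B = u j *s b" using parallel_columns[OF par] by blast
  define d where "d = k2 * (\<Sum>j\<in>UNIV. u j * \<beta> $ j)"
  have "A *v (k1 *s \<alpha>) = k2 *s (B *v \<beta>)" using g by (simp add: glues_def matrix_vector_mult_smult)
  also have "\<dots> = d *s b" unfolding matrix_vector_mult_multiples[OF b] d_def by (simp add: vector_smult_assoc)
  finally have x: "A *v (k1 *s \<alpha>) = d *s b" .
  have "A *v (k1 *s \<alpha>) \<noteq> 0"
    using glues_nonzero(1)[OF g k nz] k vector_mult_left_cancel_nat[of k1 "A *v \<alpha>" 0]
    by (simp add: matrix_vector_mult_smult)
  then have "d \<ge> 1" using x by (cases "d = 0") (auto simp: vec_eq_iff)
  then show ?thesis using gluing_condition_iff[OF nz(2)] b x by blast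
qed

text \<open>If \<open>B\<close> has two independent columns, then all columns of \<open>A\<close>
  are parallel to the nonzero vector \<open>A *v \<alpha>\<close>; otherwise all columns of
  \<open>B\<close> are parallel to any one of them.\<close>

lemma glues_imp_gluing_condition_either:
  fixes A :: "nat ^ 'p::finite ^ 2" and B :: "nat ^ 'q::finite ^ 2"
  assumes g: "glues k1 k2 A B \<alpha> \<beta>" and k: "0 < k1" "0 < k2"
    and nz: "\<And>i. column i A \<noteq> 0" "\<And>j. column j B \<noteq> 0"
  shows "gluing_condition A B \<or> gluing_condition B A"
proof (cases "\<exists>j l. cross2 (column j B) (column l B) \<noteq> 0")
  case True
  then have "cross2 (column i A) (A *v \<alpha>) = 0" for i using glues_imp_parallel[OF g k(2)] by blast
  then have "gluing_condition B A"
    using glues_imp_gluing_condition[OF glues_swap[OF g k(2)] k(2,1) nz(2,1)] glues_nonzero(1)[OF g k nz] by blast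
  then show ?thesis ..
next
  case False
  then show ?thesis using glues_imp_gluing_condition[OF g k nz, of "column undefined B"] nz(2) by blast
qed

section \<open>Arithmetic of the multipliers and construction of a gluing\<close>

lemma bezout_finite:
  fixes u :: "'a \<Rightarrow> nat"
  assumes "finite J"
  shows "\<exists>g z. (\<forall>j\<in>J. g dvd u j) \<and> (\<Sum>j\<in>J. z j * int (u j)) = int g"
  using assms
proof (induction J)
  case empty
  then show ?case by auto
next
  case (insert k J)
  then obtain g z where g: "\<forall>j\<in>J. g dvd u j" "(\<Sum>j\<in>J. z j * int (u j)) = int g" by blast
  obtain s t where st: "s * int (u k) + t * int g = gcd (int (u k)) (int g)" using bezout_int by blast
  define z' where "z' j = (if j = k then s else t * z j)" for j
  have "(\<Sum>j\<in>J. z' j * int (u j)) = t * (\<Sum>j\<in>J. z j * int (u j))"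
    unfolding sum_distrib_left using insert.hyps by (intro sum.cong) (auto simp: z'_def)
  then have "(\<Sum>j\<in>insert k J. z' j * int (u j)) = int (gcd (u k) g)"
    using insert.hyps g(2) st by (simp add: z'_def gcd_int_int_eq)
  moreover have "\<forall>j\<in>insert k J. gcd (u k) g dvd u j" using g(1) by (auto intro: dvd_trans)
  ultimately show ?case by blast
qed

text \<open>
  With \<open>g\<close> the greatest common divisor of the \<open>u\<^sub>j\<close>, the semigroup that they generate contains some
  \<open>g m\<close> with \<open>m \<equiv> 1\<close> modulo \<open>N\<close>: shift Bezout coefficients by multiples of \<open>N\<close> to make them positive.
\<close>

lemma coprime_combination:
  fixes u :: "'q::finite \<Rightarrow> nat"
  assumes u: "u k > 0" and N: "N > 0"
  obtains g m \<beta> where "g > 0" "m > 0" "coprime m N" "\<And>j. g dvd u j" "(\<Sum>j\<in>UNIV. u j * \<beta> j) = g * m"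
proof -
  obtain g z where g: "\<And>j. g dvd u j" "(\<Sum>j\<in>UNIV. z j * int (u j)) = int g"
    using bezout_finite[of "UNIV :: 'q set" u] by auto
  have g0: "g > 0" using g(1)[of k] u by (cases "g = 0") auto
  define \<beta> where "\<beta> j = nat (z j mod int N) + N" for j
  define M where "M = (\<Sum>j\<in>UNIV. u j * \<beta> j)"
  have "g dvd M" unfolding M_def using g(1) by (intro dvd_sum) auto
  then obtain m where m: "M = g * m" by (auto simp: dvd_def)
  have "u k * \<beta> k \<le> M" unfolding M_def by (rule member_le_sum) auto
  moreover have "u k * \<beta> k > 0" using u N by (simp add: \<beta>_def)
  ultimately have "M > 0" by linarith
  then have m0: "m > 0" using m by auto
  have \<beta>_cong: "int (\<beta> j) = z j + int N * (1 - z j div int N)" for j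
  proof -
    have "int (\<beta> j) = z j mod int N + int N" using N by (simp add: \<beta>_def)
    also have "\<dots> = z j + int N * (1 - z j div int N)"
      using div_mult_mod_eq[of "z j" "int N"] by (simp add: algebra_simps)
    finally show ?thesis .
  qed
  have udiv: "int (u j) = int g * int (u j div g)" for j using g(1)[of j] by (metis dvd_mult_div_cancel of_nat_mult)
  have "int g * int m = (\<Sum>j\<in>UNIV. int (u j) * int (\<beta> j))" using m by (simp add: M_def flip: of_nat_mult of_nat_sum)
  also have "\<dots> = (\<Sum>j\<in>UNIV. z j * int (u j) + int g * (int N * (int (u j div g) * (1 - z j div int N))))"
    by (intro sum.cong refl) (subst \<beta>_cong, simp add: distrib_left udiv mult_ac)
  also have "\<dots> = int g * (1 + int N * (\<Sum>j\<in>UNIV. int (u j div g) * (1 - z j div int N)))"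
    by (simp add: sum.distrib g(2) distrib_left sum_distrib_left)
  finally have "int m = 1 + int N * (\<Sum>j\<in>UNIV. int (u j div g) * (1 - z j div int N))"
    using g0 by simp
  then obtain y where y: "int m = 1 + int N * y" by blast
  have "is_unit c" if c: "c dvd int m" "c dvd int N" for c
  proof -
    have "c dvd int m - int N * y" using c by (intro dvd_diff dvd_mult2)
    then show ?thesis using y by simp
  qed
  then have "coprime (int m) (int N)" by (rule coprimeI)
  then show ?thesis using that[OF g0 m0 _ g(1)] m by (simp add: M_def)
qed

lemma gluing_condition_imp_glues:
  fixes A :: "nat ^ 'p::finite ^ 2" and B :: "nat ^ 'q::finite ^ 2"
  assumes cond: "gluing_condition A B" and nz: "\<And>j. column j B \<noteq> 0"
  shows "\<exists>k1>0. \<exists>k2>0. \<exists>\<alpha> \<beta>. glues k1 k2 A B \<alpha> \<beta>"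
proof -
  obtain b u d x where b: "\<And>j. column j B = u j *s b" and d: "d \<ge> 1" "A *v x = d *s b"
    using cond gluing_condition_iff[OF nz] by metis
  have "column undefined B \<noteq> 0" by (rule nz)
  then have "b \<noteq> 0" and u: "u undefined > 0" using b[of undefined] by (auto simp: vec_eq_iff)
  then obtain r where r: "b $ r > 0" by (auto simp: vec_eq_iff)
  \<comment> \<open>The modulus contains \<open>b $ r\<close> because the divisibility will be read
    off in coordinate \<open>r\<close>, where \<open>b\<close> does not vanish, and \<open>d\<close>
    because the \<open>B\<close>-side is scaled by \<open>d\<close>.\<close>
  obtain g m \<beta> where g: "g > 0" "m > 0" "coprime m (d * b $ r)" "\<And>j. g dvd u j"
    "(\<Sum>j\<in>UNIV. u j * \<beta> j) = g * m"
    using coprime_combination[where u = u and N = "d * b $ r", OF u] d(1) r by auto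
  define \<beta>' where "\<beta>' = (\<chi> j. \<beta> j)"
  have B\<beta>: "B *v \<beta>' = (g * m) *s b" unfolding matrix_vector_mult_multiples[OF b] by (simp add: \<beta>'_def g(5))
  have "multiple_apart (A *v x) (A *v y) (A *v y')"
    if eq: "(g * m) *s (A *v y) + d *s (B *v w) = (g * m) *s (A *v y') + d *s (B *v w')" for y w y' w'
  proof -
    define U where "U w = (\<Sum>j\<in>UNIV. u j * w $ j)" for w :: "nat ^ 'q"
    have BU: "B *v w = U w *s b" for w unfolding U_def by (rule matrix_vector_mult_multiples[OF b])
    have "g dvd U w" for w unfolding U_def using g(4) by (intro dvd_sum) auto
    \<comment> \<open>All elements of the \<open>B\<close>-side are multiples of
      \<open>g *s b\<close>, so the factor \<open>g\<close> of the multiplier cancels and only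
      \<open>m\<close> has to be matched.\<close>
    then obtain t t' where t: "U w = g * t" "U w' = g * t'" by (meson dvdE)
    define a a' where "a s = int ((A *v y) $ s)" and "a' s = int ((A *v y') $ s)" for s
    have eqs: "int m * (a s - a' s) = int d * (int t' - int t) * int (b $ s)" for s
    proof -
      have "int (((g * m) *s (A *v y) + d *s (B *v w)) $ s) = int (((g * m) *s (A *v y') + d *s (B *v w')) $ s)"
        using eq by simp
      then have "int g * (int m * (a s - a' s)) = int g * (int d * (int t' - int t) * int (b $ s))"
        unfolding BU t by (simp add: a_def a'_def algebra_simps)
      then show ?thesis using g(1) by simp
    qed
    have "(int t' - int t) * int (d * b $ r) = int m * (a r - a' r)"
      unfolding eqs by simp
    then have "int m dvd (int t' - int t) * int (d * b $ r)" by (simp only: dvd_triv_left)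
    moreover have "coprime (int m) (int (d * b $ r))" using g(3) by (simp only: coprime_int_iff)
    ultimately have "int m dvd int t' - int t" by (simp only: coprime_dvd_mult_left_iff)
    then obtain c where c: "int t' - int t = int m * c" by (auto simp: dvd_def)
    have diff: "a s - a' s = c * int (d * b $ s)" for s
    proof -
      have "int m * (a s - a' s) = int m * (c * int (d * b $ s))" using eqs[of s] unfolding c by (simp add: mult_ac)
      then show ?thesis using g(2) by simp
    qed
    \<comment> \<open>The integer factor \<open>c\<close> is split into its positive and negative
      parts, one for each side.\<close>
    have "int ((A *v y + nat (- c) *s (A *v x)) $ s) = int ((A *v y' + nat c *s (A *v x)) $ s)" for s
    proof -
      have "int (nat c) = c + int (nat (- c))" by simp
      then show ?thesis using diff[of s] unfolding d(2) by (simp add: a_def a'_def algebra_simps)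
    qed
    then have "A *v y + nat (- c) *s (A *v x) = A *v y' + nat c *s (A *v x)"
      unfolding of_nat_eq_iff vec_eq_iff by blast
    then show ?thesis unfolding multiple_apart_def by blast
  qed
  moreover have "(g * m) *s (A *v x) = d *s (B *v \<beta>')"
    unfolding d(2) B\<beta> by (simp add: vector_smult_assoc mult.commute)
  moreover have "x \<noteq> 0"
  proof
    assume "x = 0"
    then have "(d *s b) $ r = 0" using d(2) by (metis matrix_vector_mult_0_right zero_index)
    then show False using d(1) r by simp
  qed
  ultimately have "glues (g * m) d A B x \<beta>'" unfolding glues_def by blast
  moreover have "g * m > 0" "d > 0" using g(1,2) d(1) by simp_all
  ultimately show ?thesis by blast
qed

subsection \<open>The semigroup ring of a gluing\<close>

lemma generated_semigroup_glue:
  "generated_semigroup (glue_matrix k1 k2 A B) =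
     {k1 *s a + k2 *s b | a b. a \<in> generated_semigroup A \<and> b \<in> generated_semigroup B}"
  for A :: "nat ^ 'p::finite ^ 2" and B :: "nat ^ 'q::finite ^ 2"
proof -
  have "range (\<lambda>x. glue_matrix k1 k2 A B *v x) = {k1 *s (A *v u) + k2 *s (B *v w) | u w. True}"
  proof safe
    fix x :: "nat ^ ('p + 'q)"
    obtain u w where "x = vec_join u w" by (rule vec_join_cases)
    then show "\<exists>u w. glue_matrix k1 k2 A B *v x = k1 *s (A *v u) + k2 *s (B *v w) \<and> True"
      by (auto simp: glue_matrix_mult)
  next
    fix u w
    show "k1 *s (A *v u) + k2 *s (B *v w) \<in> range (\<lambda>x. glue_matrix k1 k2 A B *v x)"
      by (metis glue_matrix_mult rangeI)
  qed
  then show ?thesis unfolding generated_semigroup_def by blast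
qed

lemma generated_semigroup_add:
  "a \<in> generated_semigroup A \<Longrightarrow> b \<in> generated_semigroup A \<Longrightarrow> a + b \<in> generated_semigroup A"
  unfolding generated_semigroup_def by (auto simp flip: matrix_vector_right_distrib)

lemma generated_semigroup_smult:
  "a \<in> generated_semigroup A \<Longrightarrow> n *s a \<in> generated_semigroup A"
  unfolding generated_semigroup_def by (auto simp flip: matrix_vector_mult_smult)

section \<open>Apery sets\<close>

definition apery_set :: "(nat ^ 'n) set \<Rightarrow> nat ^ 'n \<Rightarrow> (nat ^ 'n) set" where
  "apery_set S d = {w \<in> S. \<forall>w'\<in>S. w \<noteq> w' + d}"

text \<open>Subtracting \<open>d\<close> as long as the result stays in \<open>S\<close> must stop,
  since \<open>d \<noteq> 0\<close> lowers the sum of the coordinates.\<close>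

lemma apery_set_decomposition:
  assumes "w \<in> S" "d \<noteq> 0"
  shows "\<exists>v\<in>apery_set S d. \<exists>n. w = v + n *s d"
  using assms(1)
proof (induction "\<Sum>i\<in>UNIV. w $ i" arbitrary: w rule: less_induct)
  case less
  show ?case
  proof (cases "w \<in> apery_set S d")
    case True
    then show ?thesis by (intro bexI[of _ w] exI[of _ 0]) auto
  next
    case False
    then obtain w' where w': "w' \<in> S" "w = w' + d" using less.prems by (auto simp: apery_set_def)
    obtain i where "d $ i \<noteq> 0" using assms(2) by (auto simp: vec_eq_iff)
    then have "(\<Sum>i\<in>UNIV. w' $ i) < (\<Sum>i\<in>UNIV. w $ i)"
      unfolding w'(2) by (intro sum_strict_mono_ex1) auto
    then obtain v n where "v \<in> apery_set S d" "w' = v + n *s d" using less.hyps w'(1) by blast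
    moreover from this have "w = v + Suc n *s d" unfolding w'(2) by (simp add: vec_eq_iff)
    ultimately show ?thesis by blast
  qed
qed

text \<open>With \<open>B *v \<beta> = U *s b\<close>, \<open>U\<close> copies of column
  \<open>j\<close> add up to \<open>u j\<close> copies of \<open>B *v \<beta>\<close>, of which
  there is at least one. So an element of the Apery set has no representation with a coefficient
  \<open>U\<close> or larger, and finitely many coefficient vectors remain.\<close>

lemma finite_apery_set:
  fixes B :: "nat ^ 'q::finite ^ 2"
  assumes b: "\<And>j. column j B = u j *s b" and u: "\<And>j. u j > 0"
  shows "finite (apery_set (generated_semigroup B) (B *v \<beta>))"
proof -
  define U where "U = (\<Sum>j\<in>UNIV. u j * \<beta> $ j)"
  have d: "B *v \<beta> = U *s b" unfolding U_def by (rule matrix_vector_mult_multiples[OF b])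
  have "apery_set (generated_semigroup B) (B *v \<beta>) \<subseteq> (*v) B ` {x. \<forall>j. x $ j \<in> {..<U}}"
  proof
    fix w assume w: "w \<in> apery_set (generated_semigroup B) (B *v \<beta>)"
    then obtain x where x: "w = B *v x" by (auto simp: apery_set_def generated_semigroup_def)
    have "x $ j < U" for j
    proof (rule ccontr)
      assume j: "\<not> x $ j < U"
      define y where "y = (\<chi> i. if i = j then x $ j - U else x $ i)"
      have xy: "x = y + axis j U" using j by (auto simp: vec_eq_iff y_def axis_def)
      have "B *v axis j U = (U * u j) *s b" by (simp add: matrix_vector_mult_axis b vector_smult_assoc)
      also have "\<dots> = (u j - 1) *s (B *v \<beta>) + B *v \<beta>"
        unfolding d using u[of j] by (cases "u j") (auto simp: vec_eq_iff algebra_simps)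
      finally have "w = (B *v y + (u j - 1) *s (B *v \<beta>)) + B *v \<beta>"
        unfolding x xy by (simp add: matrix_vector_right_distrib add.assoc)
      moreover have "B *v y + (u j - 1) *s (B *v \<beta>) \<in> generated_semigroup B"
        by (intro generated_semigroup_add generated_semigroup_smult) (auto simp: generated_semigroup_def)
      ultimately show False using w unfolding apery_set_def by blast
    qed
    then show "w \<in> (*v) B ` {x. \<forall>j. x $ j \<in> {..<U}}" unfolding x by auto
  qed
  moreover have "finite {x :: nat ^ 'q. \<forall>j. x $ j \<in> {..<U}}"
  proof (rule finite_subset)
    show "{x :: nat ^ 'q. \<forall>j. x $ j \<in> {..<U}} \<subseteq> vec_lambda ` (UNIV \<rightarrow>\<^sub>E {..<U})"
    proof
      fix x :: "nat ^ 'q" assume "x \<in> {x. \<forall>j. x $ j \<in> {..<U}}"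
      then have "x = vec_lambda (\<lambda>j. x $ j)" "(\<lambda>j. x $ j) \<in> UNIV \<rightarrow>\<^sub>E {..<U}" by auto
      then show "x \<in> vec_lambda ` (UNIV \<rightarrow>\<^sub>E {..<U})" by blast
    qed
  qed (simp add: finite_PiE)
  ultimately show ?thesis by (rule finite_surj[rotated])
qed

text \<open>By the swapped gluing condition \<open>w\<close> and \<open>w'\<close> differ by a
  multiple of \<open>B *v \<beta>\<close>. An element of the Apery set never arises from another
  element of the semigroup by adding such a multiple, so \<open>w = w'\<close>, and cancellation
  gives \<open>a = a'\<close>.\<close>

lemma glues_apery_unique:
  assumes g: "glues k1 k2 A B \<alpha> \<beta>" and k: "0 < k1" "0 < k2" and \<beta>: "B *v \<beta> \<noteq> 0"
    and ap: "w \<in> apery_set (generated_semigroup B) (B *v \<beta>)" "w' \<in> apery_set (generated_semigroup B) (B *v \<beta>)"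
    and a: "a \<in> generated_semigroup A" "a' \<in> generated_semigroup A"
    and eq: "k1 *s a + k2 *s w = k1 *s a' + k2 *s w'"
  shows "a = a' \<and> w = w'"
proof -
  have no_shift: "v = v'" if "v = v' + t *s (B *v \<beta>)" "v' \<in> generated_semigroup B"
    "v \<in> apery_set (generated_semigroup B) (B *v \<beta>)" for v v' t
  proof (cases t)
    case 0
    then show ?thesis using that by simp
  next
    case (Suc s)
    then have "v = (v' + s *s (B *v \<beta>)) + B *v \<beta>" using that(1) by (simp add: vec_eq_iff)
    moreover have "v' + s *s (B *v \<beta>) \<in> generated_semigroup B"
      using that(2) by (intro generated_semigroup_add generated_semigroup_smult) (auto simp: generated_semigroup_def)
    ultimately show ?thesis using that(3) unfolding apery_set_def by blast
  qed
  have wS: "w \<in> generated_semigroup B" "w' \<in> generated_semigroup B" using ap by (auto simp: apery_set_def)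
  have "k2 *s w + k1 *s a = k2 *s w' + k1 *s a'" using eq by (simp add: add.commute)
  then have "multiple_apart (B *v \<beta>) w w'"
    using glues_swap[OF g k(2)] wS a unfolding glues_def generated_semigroup_def by blast
  then have "w = w'"
    using no_shift[of w w'] no_shift[of w' w] ap wS by (elim multiple_apart_cases) auto
  then have "k1 *s a = k1 *s a'" using eq by simp
  then show ?thesis using vector_mult_left_cancel_nat[OF k(1), of a a'] \<open>w = w'\<close> by blast
qed

lemma finsum_semigroup_ring:
  assumes "finite J" "\<And>j. j \<in> J \<Longrightarrow> f j \<in> carrier (semigroup_ring A :: ('k::field, 2) mpoly ring)"
  shows "finsum (semigroup_ring A :: ('k, 2) mpoly ring) f J = (\<Sum>j\<in>J. f j)"
proof -
  interpret cring "semigroup_ring A :: ('k, 2) mpoly ring" by (rule cring_semigroup_ring)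
  show ?thesis
    using assms
  proof (induction J)
    case empty
    then show ?case by (simp add: semigroup_ring_simps)
  next
    case (insert j J)
    then have "finsum (semigroup_ring A) f (insert j J) = f j \<oplus>\<^bsub>semigroup_ring A\<^esub> finsum (semigroup_ring A) f J"
      by (intro finsum_insert) auto
    then show ?case using insert by (simp add: semigroup_ring_simps)
  qed
qed

lemma keys_push: "Poly_Mapping.keys (push q f) \<subseteq> q ` Poly_Mapping.keys f"
proof
  fix x assume "x \<in> Poly_Mapping.keys (push q f)"
  then have "(\<Sum>v | v \<in> Poly_Mapping.keys f \<and> q v = x. Poly_Mapping.lookup f v) \<noteq> 0"
    by (simp add: in_keys_iff lookup_push)
  then have "{v \<in> Poly_Mapping.keys f. q v = x} \<noteq> {}" by (intro notI) simp
  then show "x \<in> q ` Poly_Mapping.keys f" by blast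
qed

lemma push_mult_single:
  fixes q :: "'a \<Rightarrow> 'b::monoid_add"
  shows "push q f * Poly_Mapping.single w 1 = push (\<lambda>v. q v + w) f"
  by (simp add: push_def sum_distrib_right mult_single)

text \<open>Multiples of \<open>k2 *s (B *v \<beta>)\<close> can be counted as multiples of
  \<open>k1 *s (A *v \<alpha>)\<close>, so the monomials with exponents \<open>k2 *s w\<close>,
  \<open>w\<close> in the Apery set, span over the image of the map that scales exponents by
  \<open>k1\<close>. Their independence is \<open>glues_apery_unique\<close>.\<close>

lemma cohen_macaulay_glue:
  fixes A :: "nat ^ 'p::finite ^ 2" and B :: "nat ^ 'q::finite ^ 2"
  assumes g: "glues k1 k2 A B \<alpha> \<beta>" and k: "0 < k1" "0 < k2"
    and nzA: "\<And>i. column i A \<noteq> 0" and nzB: "\<And>j. column j B \<noteq> 0"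
    and b: "\<And>j. column j B = u j *s b"
    and CM: "cohen_macaulay (semigroup_ring A :: ('k::field, 2) mpoly ring)"
  shows "cohen_macaulay (semigroup_ring (glue_matrix k1 k2 A B) :: ('k, 2) mpoly ring)"
proof -
  let ?R = "semigroup_ring A :: ('k, 2) mpoly ring"
  let ?S = "semigroup_ring (glue_matrix k1 k2 A B) :: ('k, 2) mpoly ring"
  let ?h = "push ((*s) k1) :: ('k, 2) mpoly \<Rightarrow> ('k, 2) mpoly"
  define d where "d = B *v \<beta>"
  have d0: "d \<noteq> 0" unfolding d_def using glues_nonzero(2)[OF g k nzA nzB] .
  define J where "J = apery_set (generated_semigroup B) d"
  define e where "e w = Poly_Mapping.single (k2 *s w) (1::'k)" for w :: "nat ^ 2"
  interpret R: cring ?R by (rule cring_semigroup_ring)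
  interpret S: cring ?S by (rule cring_semigroup_ring)
  have "u j > 0" for j using b[of j] nzB[of j] by (cases "u j = 0") (auto simp: vec_eq_iff)
  then have finJ: "finite J" unfolding J_def d_def using finite_apery_set[OF b] by blast
  have JB: "w \<in> generated_semigroup B" if "w \<in> J" for w using that by (simp add: J_def apery_set_def)
  have zero: "0 \<in> generated_semigroup M" for M :: "nat ^ 'm::finite ^ 2"
    unfolding generated_semigroup_def by (metis matrix_vector_mult_0_right rangeI)
  have glueI: "k1 *s a + k2 *s w \<in> generated_semigroup (glue_matrix k1 k2 A B)"
    if "a \<in> generated_semigroup A" "w \<in> generated_semigroup B" for a w
    using that unfolding generated_semigroup_glue by blast
  have he: "?h f * e w = push (\<lambda>v. k1 *s v + k2 *s w) f" for f w
    unfolding e_def by (rule push_mult_single)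
  have hom: "?h \<in> ring_hom ?R ?S"
  proof (rule ring_hom_memI, unfold semigroup_ring_simps)
    fix f g :: "('k, 2) mpoly"
    show "?h (f * g) = ?h f * ?h g" by (rule push_mult) (simp add: vector_add_ldistrib)
    show "?h (f + g) = ?h f + ?h g" by simp
    show "?h 1 = 1" by (simp flip: single_one)
    assume "f \<in> {f. Poly_Mapping.keys f \<subseteq> generated_semigroup A}"
    then show "?h f \<in> {f. Poly_Mapping.keys f \<subseteq> generated_semigroup (glue_matrix k1 k2 A B)}"
      using keys_push[of "(*s) k1" f] glueI[OF _ zero[of B]] by fastforce
  qed
  have e_closed: "e w \<in> carrier ?S" if "w \<in> J" for w
    using glueI[OF zero[of A] JB[OF that]] by (simp add: e_def semigroup_ring_simps)
  have h_closed: "?h f \<in> carrier ?S" if "f \<in> carrier ?R" for f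
    using hom that by (rule ring_hom_closed)
  have finsum_eq: "(\<Oplus>\<^bsub>?S\<^esub>w\<in>J. ?h (c w) \<otimes>\<^bsub>?S\<^esub> e w) = (\<Sum>w\<in>J. push (\<lambda>v. k1 *s v + k2 *s w) (c w))"
    if c: "c \<in> J \<rightarrow> carrier ?R" for c
  proof -
    have "(\<Oplus>\<^bsub>?S\<^esub>w\<in>J. ?h (c w) \<otimes>\<^bsub>?S\<^esub> e w) = (\<Sum>w\<in>J. ?h (c w) \<otimes>\<^bsub>?S\<^esub> e w)"
      using finJ c h_closed e_closed by (intro finsum_semigroup_ring S.m_closed) auto
    then show ?thesis by (simp add: semigroup_ring_simps he)
  qed
  have decomp: "\<exists>a\<in>generated_semigroup A. \<exists>w\<in>J. v = k1 *s a + k2 *s w"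
    if v: "v \<in> generated_semigroup (glue_matrix k1 k2 A B)" for v
  proof -
    obtain a w where aw: "v = k1 *s a + k2 *s w" "a \<in> generated_semigroup A" "w \<in> generated_semigroup B"
      using v unfolding generated_semigroup_glue by blast
    obtain w0 n where w0: "w0 \<in> J" "w = w0 + n *s d"
      using apery_set_decomposition[OF aw(3) d0] unfolding J_def by blast
    have "k1 *s (A *v \<alpha>) = k2 *s d" using g by (simp add: glues_def d_def)
    then have "k2 *s (n *s d) = k1 *s (n *s (A *v \<alpha>))" by (metis mult.commute vector_smult_assoc)
    then have "v = k1 *s (a + n *s (A *v \<alpha>)) + k2 *s w0"
      unfolding aw(1) w0(2) by (simp add: vector_add_ldistrib add_ac)
    moreover have "a + n *s (A *v \<alpha>) \<in> generated_semigroup A"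
      using aw(2) by (intro generated_semigroup_add generated_semigroup_smult) (auto simp: generated_semigroup_def)
    ultimately show ?thesis using w0(1) by blast
  qed
  have "finite_free_extension ?R ?S ?h J e"
  proof (intro finite_free_extension.intro finite_extension.intro ring_hom_cring.intro
      ring_hom_cring_axioms.intro finite_extension_axioms.intro finite_free_extension_axioms.intro)
    show "cring ?R" "cring ?S" by (rule cring_semigroup_ring)+
    show "?h \<in> ring_hom ?R ?S" by (rule hom)
    show "finite J" by (rule finJ)
    show "e \<in> J \<rightarrow> carrier ?S" using e_closed by auto
    show "noetherian_ring ?R" using CM by (simp add: cohen_macaulay_def)
    fix f assume "f \<in> carrier ?S"
    then have f: "Poly_Mapping.keys f \<subseteq> generated_semigroup (glue_matrix k1 k2 A B)" by (simp add: semigroup_ring_simps)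
    have "\<exists>c\<in>J \<rightarrow> carrier ?R. f = (\<Sum>w\<in>J. push (\<lambda>v. k1 *s v + k2 *s w) (c w))"
    proof (induction f rule: poly_mapping_additive_induct)
      case zero
      then show ?case by (intro bexI[of _ "\<lambda>_. 0"]) (auto simp: semigroup_ring_simps)
    next
      case (single v r)
      then obtain a w where aw: "a \<in> generated_semigroup A" "w \<in> J" "v = k1 *s a + k2 *s w" using decomp f by blast
      define c where "c w' = (if w' = w then Poly_Mapping.single a r else 0)" for w'
      have "(\<Sum>w\<in>J. push (\<lambda>v. k1 *s v + k2 *s w) (c w)) = (\<Sum>w'\<in>J. if w' = w then Poly_Mapping.single v r else 0)"
        by (intro sum.cong) (auto simp: c_def aw(3))
      then have "Poly_Mapping.single v r = (\<Sum>w\<in>J. push (\<lambda>v. k1 *s v + k2 *s w) (c w))"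
        using aw(2) finJ by simp
      moreover have "c \<in> J \<rightarrow> carrier ?R" using aw(1) by (auto simp: c_def semigroup_ring_simps)
      ultimately show ?case by blast
    next
      case (add f g)
      then obtain c c' where "c \<in> J \<rightarrow> carrier ?R" "f = (\<Sum>w\<in>J. push (\<lambda>v. k1 *s v + k2 *s w) (c w))"
        "c' \<in> J \<rightarrow> carrier ?R" "g = (\<Sum>w\<in>J. push (\<lambda>v. k1 *s v + k2 *s w) (c' w))" by blast
      moreover from this have "(\<lambda>w. c w + c' w) \<in> J \<rightarrow> carrier ?R"
        using R.a_closed by (auto simp: semigroup_ring_simps(3) Pi_iff)
      ultimately show ?case by (intro bexI[of _ "\<lambda>w. c w + c' w"]) (auto simp: sum.distrib)
    qed
    then obtain c where c: "c \<in> J \<rightarrow> carrier ?R" "f = (\<Sum>w\<in>J. push (\<lambda>v. k1 *s v + k2 *s w) (c w))" by blast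
    show "\<exists>c\<in>J \<rightarrow> carrier ?R. f = (\<Oplus>\<^bsub>?S\<^esub>w\<in>J. ?h (c w) \<otimes>\<^bsub>?S\<^esub> e w)"
      unfolding c(2) finsum_eq[OF c(1), symmetric] using c(1) by blast
  next
    fix c w0 assume c: "c \<in> J \<rightarrow> carrier ?R" and zero: "(\<Oplus>\<^bsub>?S\<^esub>w\<in>J. ?h (c w) \<otimes>\<^bsub>?S\<^esub> e w) = \<zero>\<^bsub>?S\<^esub>" and w0: "w0 \<in> J"
    have keys: "Poly_Mapping.keys (c w) \<subseteq> generated_semigroup A" if "w \<in> J" for w
      using c that by (auto simp: semigroup_ring_simps)
    have "Poly_Mapping.lookup (c w0) a = 0" if a: "a \<in> generated_semigroup A" for a
    proof -
      \<comment> \<open>The exponent \<open>k1 *s a + k2 *s w0\<close> determines \<open>a\<close>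
        and \<open>w0\<close>, so the only possible contribution to it is the coefficient of
        \<open>c w0\<close> at \<open>a\<close>.\<close>
      have uniq: "k1 *s v + k2 *s w = k1 *s a + k2 *s w0 \<longleftrightarrow> v = a \<and> w = w0"
        if "v \<in> generated_semigroup A" "w \<in> J" for v w
        using glues_apery_unique[OF g k _ _ _ that(1) a, of w w0] that(2) w0 d0 unfolding J_def d_def by blast
      have "Poly_Mapping.lookup (push (\<lambda>v. k1 *s v + k2 *s w) (c w)) (k1 *s a + k2 *s w0)
          = (if w = w0 then Poly_Mapping.lookup (c w0) a else 0)" if w: "w \<in> J" for w
      proof -
        have "{v \<in> Poly_Mapping.keys (c w). k1 *s v + k2 *s w = k1 *s a + k2 *s w0} =
            {v \<in> Poly_Mapping.keys (c w). v = a \<and> w = w0}"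
          using uniq[OF _ w] keys[OF w] by blast
        also have "\<dots> = (if w = w0 \<and> a \<in> Poly_Mapping.keys (c w) then {a} else {})" by auto
        finally show ?thesis unfolding lookup_push by (auto simp: in_keys_iff)
      qed
      then have "Poly_Mapping.lookup (\<Sum>w\<in>J. push (\<lambda>v. k1 *s v + k2 *s w) (c w)) (k1 *s a + k2 *s w0)
          = (\<Sum>w\<in>J. if w = w0 then Poly_Mapping.lookup (c w0) a else 0)"
        unfolding lookup_sum by (rule sum.cong[OF refl])
      also have "\<dots> = Poly_Mapping.lookup (c w0) a" using w0 finJ by simp
      finally show ?thesis using zero finsum_eq[OF c] by (simp add: semigroup_ring_simps)
    qed
    then have "c w0 = 0" using keys[OF w0] by (intro poly_mapping_eqI) (auto simp: in_keys_iff)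
    then show "c w0 = \<zero>\<^bsub>?R\<^esub>" by (simp add: semigroup_ring_simps)
  qed
  then show ?thesis using CM by (rule finite_free_extension.cohen_macaulay_extension)
qed

theorem theorem5p1:
  fixes A :: "nat ^ 'p :: finite ^ 2" and B :: "nat ^ 'q :: finite ^ 2"
  assumes "inj (\<lambda>i. column i A)" and "inj (\<lambda>j. column j B)"
    and "\<And>i. column i A \<noteq> 0" and "\<And>j. column j B \<noteq> 0"
    and "cohen_macaulay (semigroup_ring A :: ('k :: field, 2) mpoly ring)"
    and "cohen_macaulay (semigroup_ring B :: ('k, 2) mpoly ring)"
  shows "(can_be_glued TYPE('k) A B \<longleftrightarrow> gluing_condition A B \<or> gluing_condition B A) \<and>
         (gluing_condition A B \<or> gluing_condition B A \<longrightarrow>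
            (\<forall>k1 > 0. \<forall>k2 > 0. is_gluing TYPE('k) k1 k2 A B \<longrightarrow>
               cohen_macaulay (semigroup_ring (glue_matrix k1 k2 A B) :: ('k, 2) mpoly ring)))"
proof (intro conjI iffI impI allI)
  assume "can_be_glued TYPE('k) A B"
  then obtain k1 k2 where k: "0 < k1" "0 < k2" and "is_gluing TYPE('k) k1 k2 A B"
    unfolding can_be_glued_def by blast
  from is_gluingD[OF this(3)] obtain \<alpha> \<beta> where "glues k1 k2 A B \<alpha> \<beta>" by blast
  then show "gluing_condition A B \<or> gluing_condition B A"
    using k assms(3,4) by (rule glues_imp_gluing_condition_either)
next
  assume "gluing_condition A B \<or> gluing_condition B A"
  then obtain k1 k2 \<alpha> \<beta> where k: "0 < k1" "0 < k2" and g: "glues k1 k2 A B \<alpha> \<beta>"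
  proof
    assume "gluing_condition A B"
    from gluing_condition_imp_glues[OF this assms(4)] show ?thesis using that by blast
  next
    assume "gluing_condition B A"
    from gluing_condition_imp_glues[OF this assms(3)] obtain k1 k2 \<alpha> \<beta>
      where "0 < k1" "0 < k2" "glues k1 k2 B A \<alpha> \<beta>" by blast
    then show ?thesis using that[of k2 k1] glues_swap[of k1 k2 B A] by blast
  qed
  show "can_be_glued TYPE('k) A B"
    unfolding can_be_glued_def using k is_gluingI[OF g k(2)] by blast
next
  fix k1 k2 :: nat
  assume cond: "gluing_condition A B \<or> gluing_condition B A" and k: "0 < k1" "0 < k2"
    and glue: "is_gluing TYPE('k) k1 k2 A B"
  obtain \<alpha> \<beta> where g: "glues k1 k2 A B \<alpha> \<beta>" using is_gluingD[OF glue] by blast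
  show "cohen_macaulay (semigroup_ring (glue_matrix k1 k2 A B) :: ('k, 2) mpoly ring)"
    using cond
  proof
    assume "gluing_condition A B"
    then obtain b u where b: "\<And>j. column j B = u j *s b" using gluing_condition_iff[of B A, OF assms(4)] by blast
    show ?thesis by (rule cohen_macaulay_glue[OF g k assms(3,4) b assms(5)])
  next
    assume "gluing_condition B A"
    then obtain b u where b: "\<And>j. column j A = u j *s b" using gluing_condition_iff[of A B, OF assms(3)] by blast
    \<comment> \<open>Here \<open>A\<close> lies on a line, so \<open>k[C]\<close> is free over a
      copy of \<open>k[B]\<close>, and it is the Cohen-Macaulay property of \<open>k[B]\<close> that
      is passed on.\<close>
    have "cohen_macaulay (semigroup_ring (glue_matrix k2 k1 B A) :: ('k, 2) mpoly ring)"
      by (rule cohen_macaulay_glue[OF glues_swap[OF g k(2)] k(2,1) assms(4,3) b assms(6)])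
    \<comment> \<open>The two orders of gluing have different index types but the same set of
      exponents, which is all that \<open>semigroup_ring\<close> sees.\<close>
    moreover have "generated_semigroup (glue_matrix k2 k1 B A) = generated_semigroup (glue_matrix k1 k2 A B)"
      unfolding generated_semigroup_glue by (metis (no_types, lifting) add.commute)
    ultimately show ?thesis by (simp add: semigroup_ring_def)
  qed
qed

end
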